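(* Let $(X,x)$ be a pointed Kan complex and $n\ge 0$. The natural bijection between the set of pointed cubical maps $(\square^n/\partial\square^n,[0])\to(X,x)$ and the set $\Omega^n(X,x)_0$ of $0$-cubes of the $n$-th loop space (sending a pointed map to the $0$-cube of $\Omega^n(X,x)$ represented by the $n$-cube $\square^n\to\square^n/\partial\square^n\to X$) induces a bijection $$[(\square^n/\partial\square^n,[0]),(X,x)]\cong\pi_n(X,x),$$ where the left-hand side is the set of pointed homotopy classes of pointed maps.
   Context: Cubes: $\square$ is the category whose objects are the posets $[1]^n=\{0\le 1\}^n$, $n\ge 0$, with morphisms generated under composition (inside posets) by the faces $\partial_{i,\varepsilon}\colon [1]^{n-1}\to[1]^n$ inserting $\varepsilon\in\{0,1\}$ as $i$-th coordinate, the degeneracies $\sigma_i\colon[1]^n\to[1]^{n-1}$ deleting the $i$-th coordinate, and the connections $\gamma_{i,0},\gamma_{i,1}\colon[1]^n\to[1]^{n-1}$ ($1\le i\le n-1$) replacing $x_i,x_{i+1}$ by their maximum, resp. minimum. A cubical set is a functor $X\colon\square^{op}\to\mathsf{Set}$; operators act on the right. $\square^n$ is the representable at $[1]^n$; $\partial\square^n\subseteq\square^n$ is the union of the images of all faces; the open box $\sqcap^n_{i,\varepsilon}$ is the union of the images of all faces $\partial_{j,\eta}$ with $(j,\eta)\ne(i,\varepsilon)$. The geometric product $\otimes$ is the left Kan extension of $[1]^m\otimes[1]^n=[1]^{m+n}$, and $\hom_R(X,-)$ is the right adjoint of $X\otimes -$. A Kan complex is a cubical set $X$ such that every map $\sqcap^n_{i,\varepsilon}\to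 X$ extends to $\square^n\to X$. Quotient: $\square^n/\partial\square^n$ is the pushout of $\square^n\hookleftarrow\partial\square^n\to\square^0$, pointed by the $0$-cube $[0]$ given by the structure map from $\square^0$. Loop spaces: for a pointed cubical set $(X,x)$, $\Omega(X,x)$ is the pullback of $(x,x)\colon\square^0\to X\times X$ along $(\partial_{1,0}^*,\partial_{1,1}^* )\colon\hom_R(\square^1,X)\to X\times X$, pointed at $x\sigma_1$. A $k$-cube of $\Omega(X,x)$ is thus a $(k+1)$-cube of $X$ whose $\partial_{1,0}$- and $\partial_{1,1}$-faces are degenerate at $x$. $\Omega^0(X,x)=(X,x)$, $\Omega^n(X,x)=\Omega(\Omega^{n-1}(X,x))$; iterating, a $0$-cube of $\Omega^n(X,x)$ is identified with an $n$-cube of $X$ sending $\partial\square^n$ to $x$. $\pi_0(X)$ is the colimit of $X\colon\square^{op}\to\mathsf{Set}$ (for Kan $X$: homotopy classes of $0$-cubes), and $\pi_n(X,x)=\pi_0(\Omega^n(X,x))$. A pointed homotopy between pointed maps $f,g\colon(Z,z)\to(X,x)$ is a map $H\colon Z\otimes\square^1\to X$ restricting to $f$ and $g$ at the $\partial_{1,0}$- and $\partial_{1,1}$-ends of $\square^1$ and to the constant map at $x$ on $\{z\}\otimes\square^1$. *)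

theory Defs
  imports Main "HOL-Library.FuncSet"
begin

section \<open>The cube category\<close>

text \<open>
  The poset \<open>[1]^n\<close> is rendered as the set of Boolean lists of length \<open>n\<close>.  All maps out of
  \<open>[1]^n\<close> are extensional (\<open>undefined\<close> off \<open>[1]^n\<close>), so that equality of morphisms is equality
  in HOL.  Coordinates are numbered from \<open>1\<close>.
\<close>

definition cube :: "nat \<Rightarrow> bool list set" where
  "cube n = {v. length v = n}"

text \<open>
  \<open>face n i e\<close> is \<open>\<partial>\<^sub>i\<^sub>,\<^sub>e : [1]^n \<rightarrow> [1]^(n+1)\<close>; \<open>degen n i\<close> and \<open>conn n i e\<close> are
  \<open>\<sigma>\<^sub>i, \<gamma>\<^sub>i\<^sub>,\<^sub>e : [1]^(n+1) \<rightarrow> [1]^n\<close>.  The index \<open>n\<close> is always the smaller dimension, and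
  \<open>False\<close>, \<open>True\<close> stand for \<open>0\<close>, \<open>1\<close>.
\<close>

definition face :: "nat \<Rightarrow> nat \<Rightarrow> bool \<Rightarrow> bool list \<Rightarrow> bool list" where
  "face n i e = (\<lambda>v\<in>cube n. take (i - 1) v @ [e] @ drop (i - 1) v)"

definition degen :: "nat \<Rightarrow> nat \<Rightarrow> bool list \<Rightarrow> bool list" where
  "degen n i = (\<lambda>v\<in>cube (n + 1). take (i - 1) v @ drop i v)"

definition conn :: "nat \<Rightarrow> nat \<Rightarrow> bool \<Rightarrow> bool list \<Rightarrow> bool list" where
  "conn n i e = (\<lambda>v\<in>cube (n + 1).
     take (i - 1) v @ [(if e then min else max) (v ! (i - 1)) (v ! i)] @ drop (i + 1) v)"

definition ident :: "nat \<Rightarrow> bool list \<Rightarrow> bool list" where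
  "ident n = (\<lambda>v\<in>cube n. v)"

inductive cube_mor :: "nat \<Rightarrow> nat \<Rightarrow> (bool list \<Rightarrow> bool list) \<Rightarrow> bool" where
  ident: "cube_mor n n (ident n)"
| face: "1 \<le> i \<Longrightarrow> i \<le> n + 1 \<Longrightarrow> cube_mor n (n + 1) (face n i e)"
| degen: "1 \<le> i \<Longrightarrow> i \<le> n + 1 \<Longrightarrow> cube_mor (n + 1) n (degen n i)"
| conn: "1 \<le> i \<Longrightarrow> i \<le> n \<Longrightarrow> cube_mor (n + 1) n (conn n i e)"
| comp: "cube_mor l m g \<Longrightarrow> cube_mor m n f \<Longrightarrow> cube_mor l n (compose (cube l) f g)"

definition Hom :: "nat \<Rightarrow> nat \<Rightarrow> (bool list \<Rightarrow> bool list) set" where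
  "Hom m n = {f. cube_mor m n f}"

text \<open>\<open>tens m n f g\<close> is \<open>f \<otimes> g\<close>, where \<open>[1]^m\<close> and \<open>[1]^n\<close> are the domains of \<open>f\<close> and \<open>g\<close>.\<close>

definition tens ::
  "nat \<Rightarrow> nat \<Rightarrow> (bool list \<Rightarrow> bool list) \<Rightarrow> (bool list \<Rightarrow> bool list) \<Rightarrow> bool list \<Rightarrow> bool list"
  where "tens m n f g = (\<lambda>v\<in>cube (m + n). f (take m v) @ g (drop m v))"


section \<open>Cubical sets\<close>

text \<open>
  \<open>act X m n f c\<close> is the cube \<open>c f\<close> of dimension \<open>m\<close>, for \<open>f : [1]^m \<rightarrow> [1]^n\<close> and a cube \<open>c\<close> of
  dimension \<open>n\<close>.  The values of \<open>act\<close> elsewhere are irrelevant.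
\<close>

record 'a cset =
  cells :: "nat \<Rightarrow> 'a set"
  act :: "nat \<Rightarrow> nat \<Rightarrow> (bool list \<Rightarrow> bool list) \<Rightarrow> 'a \<Rightarrow> 'a"

definition cubical_set :: "'a cset \<Rightarrow> bool" where
  "cubical_set X \<longleftrightarrow>
     (\<forall>m n. \<forall>f\<in>Hom m n. act X m n f \<in> cells X n \<rightarrow> cells X m) \<and>
     (\<forall>n. \<forall>c\<in>cells X n. act X n n (ident n) c = c) \<and>
     (\<forall>l m n. \<forall>g\<in>Hom l m. \<forall>f\<in>Hom m n. \<forall>c\<in>cells X n.
        act X l n (compose (cube l) f g) c = act X l m g (act X m n f c))"

definition maps :: "'a cset \<Rightarrow> 'b cset \<Rightarrow> (nat \<Rightarrow> 'a \<Rightarrow> 'b) set" where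
  "maps X Y = {F. (\<forall>n. F n \<in> cells X n \<rightarrow>\<^sub>E cells Y n) \<and>
     (\<forall>m n. \<forall>f\<in>Hom m n. \<forall>c\<in>cells X n. F m (act X m n f c) = act Y m n f (F n c))}"

definition representable :: "nat \<Rightarrow> (bool list \<Rightarrow> bool list) cset" where
  "representable n = \<lparr>cells = (\<lambda>m. Hom m n), act = (\<lambda>k m f c. compose (cube k) c f)\<rparr>"

text \<open>The union of the images of the faces \<open>\<partial>\<^sub>j\<^sub>,\<^sub>d : [1]^(n-1) \<rightarrow> [1]^n\<close> with \<open>(j, d) \<in> J\<close>.\<close>

definition face_union :: "nat \<Rightarrow> (nat \<times> bool) set \<Rightarrow> (bool list \<Rightarrow> bool list) cset" where
  "face_union n J = (representable n)
     \<lparr>cells := (\<lambda>m. \<Union>(j, d)\<in>J. (\<lambda>h. compose (cube m) (face (n - 1) j d) h) ` Hom m (n - 1))\<rparr>"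

definition boundary :: "nat \<Rightarrow> (bool list \<Rightarrow> bool list) cset" where
  "boundary n = face_union n ({1..n} \<times> UNIV)"

definition open_box :: "nat \<Rightarrow> nat \<Rightarrow> bool \<Rightarrow> (bool list \<Rightarrow> bool list) cset" where
  "open_box n i e = face_union n ({1..n} \<times> UNIV - {(i, e)})"

definition kan_complex :: "'a cset \<Rightarrow> bool" where
  "kan_complex X \<longleftrightarrow> cubical_set X \<and>
     (\<forall>n i e. 1 \<le> i \<and> i \<le> n \<longrightarrow>
        (\<forall>F\<in>maps (open_box n i e) X. \<exists>G\<in>maps (representable n) X.
           \<forall>m. \<forall>c\<in>cells (open_box n i e) m. G m c = F m c))"

text \<open>The degenerate \<open>k\<close>-cube at a 0-cube \<open>x\<close>, i.e. \<open>x\<close> acted on by the unique \<open>[1]^k \<rightarrow> [1]^0\<close>.\<close>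

definition terminal :: "nat \<Rightarrow> bool list \<Rightarrow> bool list" where
  "terminal k = (\<lambda>v\<in>cube k. [])"

definition const_cube :: "'a cset \<Rightarrow> 'a \<Rightarrow> nat \<Rightarrow> 'a" where
  "const_cube X x k = act X k 0 (terminal k) x"


section \<open>Colimit constructions\<close>

text \<open>For \<open>r \<subseteq> A \<times> A\<close>, the equivalence relation on \<open>A\<close> generated by \<open>r\<close>.\<close>

definition eq_closure :: "'a set \<Rightarrow> 'a rel \<Rightarrow> 'a rel" where
  "eq_closure A r = (r \<union> r\<inverse>)\<^sup>* \<inter> A \<times> A"

text \<open>
  Dimensionwise quotient by the equivalence relations generated by \<open>R\<close>.  An operator sends a
  class to the class that contains the image of its members.
\<close>

definition quot_rel :: "'a cset \<Rightarrow> (nat \<Rightarrow> 'a rel) \<Rightarrow> nat \<Rightarrow> 'a rel" where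
  "quot_rel P R m = eq_closure (cells P m) (R m)"

definition quot_cset :: "'a cset \<Rightarrow> (nat \<Rightarrow> 'a rel) \<Rightarrow> 'a set cset" where
  "quot_cset P R =
     \<lparr>cells = (\<lambda>m. cells P m // quot_rel P R m),
      act = (\<lambda>m n f S. quot_rel P R m `` (act P m n f ` S))\<rparr>"

definition coproduct :: "'a cset \<Rightarrow> 'b cset \<Rightarrow> ('a + 'b) cset" where
  "coproduct B C =
     \<lparr>cells = (\<lambda>m. cells B m <+> cells C m),
      act = (\<lambda>m n f. map_sum (act B m n f) (act C m n f))\<rparr>"

text \<open>The pushout of \<open>F : A \<rightarrow> B\<close> and \<open>G : A \<rightarrow> C\<close>, with its structure maps.\<close>

definition pushout_gen ::
  "'a cset \<Rightarrow> (nat \<Rightarrow> 'a \<Rightarrow> 'b) \<Rightarrow> (nat \<Rightarrow> 'a \<Rightarrow> 'c) \<Rightarrow> nat \<Rightarrow> ('b + 'c) rel" where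
  "pushout_gen A F G m = {(Inl (F m a), Inr (G m a)) | a. a \<in> cells A m}"

definition pushout ::
  "'a cset \<Rightarrow> 'b cset \<Rightarrow> 'c cset \<Rightarrow> (nat \<Rightarrow> 'a \<Rightarrow> 'b) \<Rightarrow> (nat \<Rightarrow> 'a \<Rightarrow> 'c) \<Rightarrow> ('b + 'c) set cset"
  where "pushout A B C F G = quot_cset (coproduct B C) (pushout_gen A F G)"

definition pushout_inl ::
  "'a cset \<Rightarrow> 'b cset \<Rightarrow> 'c cset \<Rightarrow> (nat \<Rightarrow> 'a \<Rightarrow> 'b) \<Rightarrow> (nat \<Rightarrow> 'a \<Rightarrow> 'c) \<Rightarrow> nat \<Rightarrow> 'b \<Rightarrow> ('b + 'c) set"
  where "pushout_inl A B C F G m =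
    (\<lambda>b\<in>cells B m. quot_rel (coproduct B C) (pushout_gen A F G) m `` {Inl b})"

definition pushout_inr ::
  "'a cset \<Rightarrow> 'b cset \<Rightarrow> 'c cset \<Rightarrow> (nat \<Rightarrow> 'a \<Rightarrow> 'b) \<Rightarrow> (nat \<Rightarrow> 'a \<Rightarrow> 'c) \<Rightarrow> nat \<Rightarrow> 'c \<Rightarrow> ('b + 'c) set"
  where "pushout_inr A B C F G m =
    (\<lambda>c\<in>cells C m. quot_rel (coproduct B C) (pushout_gen A F G) m `` {Inr c})"


section \<open>The cubical sphere\<close>

type_synonym sphere_cell = "((bool list \<Rightarrow> bool list) + (bool list \<Rightarrow> bool list)) set"

definition boundary_incl :: "nat \<Rightarrow> nat \<Rightarrow> (bool list \<Rightarrow> bool list) \<Rightarrow> bool list \<Rightarrow> bool list" where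
  "boundary_incl n m = (\<lambda>c\<in>cells (boundary n) m. c)"

definition boundary_collapse :: "nat \<Rightarrow> nat \<Rightarrow> (bool list \<Rightarrow> bool list) \<Rightarrow> bool list \<Rightarrow> bool list" where
  "boundary_collapse n m = (\<lambda>c\<in>cells (boundary n) m. terminal m)"

text \<open>
  \<open>\<square>^n/\<partial>\<square>^n\<close>, the quotient map from \<open>\<square>^n\<close>, and the base point \<open>[0]\<close>.  For \<open>n = 0\<close> the boundary is
  empty, so this is \<open>\<square>^0\<close> with a disjoint base point.
\<close>

definition sphere :: "nat \<Rightarrow> sphere_cell cset" where
  "sphere n = pushout (boundary n) (representable n) (representable 0)
     (boundary_incl n) (boundary_collapse n)"

definition sphere_proj :: "nat \<Rightarrow> nat \<Rightarrow> (bool list \<Rightarrow> bool list) \<Rightarrow> sphere_cell" where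
  "sphere_proj n = pushout_inl (boundary n) (representable n) (representable 0)
     (boundary_incl n) (boundary_collapse n)"

definition sphere_pt :: "nat \<Rightarrow> sphere_cell" where
  "sphere_pt n = pushout_inr (boundary n) (representable n) (representable 0)
     (boundary_incl n) (boundary_collapse n) 0 (ident 0)"


section \<open>The geometric product and pointed homotopies\<close>

type_synonym ('a, 'b) gcell = "nat \<times> nat \<times> 'a \<times> 'b \<times> (bool list \<Rightarrow> bool list)"

text \<open>
  The pointwise formula for the left Kan extension: \<open>X \<otimes> Y\<close> is the coend of
  \<open>X\<^sub>p \<times> Y\<^sub>q \<times> \<square>^(p+q)\<close> over \<open>p\<close> and \<open>q\<close>, that is, the disjoint union of these cubical sets modulo
  \<open>(c a, d b, f) ~ (c, d, (a \<otimes> b) f)\<close>.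
\<close>

definition gprod_pre :: "'a cset \<Rightarrow> 'b cset \<Rightarrow> ('a, 'b) gcell cset" where
  "gprod_pre X Y =
     \<lparr>cells = (\<lambda>k. {(p, q, c, d, f). c \<in> cells X p \<and> d \<in> cells Y q \<and> f \<in> Hom k (p + q)}),
      act = (\<lambda>j k g (p, q, c, d, f). (p, q, c, d, compose (cube j) f g))\<rparr>"

definition gprod_gen :: "'a cset \<Rightarrow> 'b cset \<Rightarrow> nat \<Rightarrow> ('a, 'b) gcell rel" where
  "gprod_gen X Y k =
     {((p', q', act X p' p a c, act Y q' q b d, f),
       (p, q, c, d, compose (cube k) (tens p' q' a b) f)) | p p' q q' a b c d f.
       a \<in> Hom p' p \<and> b \<in> Hom q' q \<and> c \<in> cells X p \<and> d \<in> cells Y q \<and> f \<in> Hom k (p' + q')}"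

definition gprod :: "'a cset \<Rightarrow> 'b cset \<Rightarrow> ('a, 'b) gcell set cset" where
  "gprod X Y = quot_cset (gprod_pre X Y) (gprod_gen X Y)"

definition gprod_class :: "'a cset \<Rightarrow> 'b cset \<Rightarrow> nat \<Rightarrow> ('a, 'b) gcell \<Rightarrow> ('a, 'b) gcell set" where
  "gprod_class X Y k u = quot_rel (gprod_pre X Y) (gprod_gen X Y) k `` {u}"

definition pointed_maps :: "'a cset \<times> 'a \<Rightarrow> 'b cset \<times> 'b \<Rightarrow> (nat \<Rightarrow> 'a \<Rightarrow> 'b) set" where
  "pointed_maps = (\<lambda>(Z, z) (X, x). {F \<in> maps Z X. F 0 z = x})"

text \<open>
  \<open>end_incl Z e : Z \<rightarrow> Z \<otimes> \<square>^1\<close> is the isomorphism \<open>Z \<cong> Z \<otimes> \<square>^0\<close>, which sends a \<open>k\<close>-cube \<open>c\<close> to the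
  class of \<open>(c, id, id)\<close>, followed by \<open>Z \<otimes> \<partial>\<^sub>1\<^sub>,\<^sub>e\<close>.
\<close>

definition end_incl ::
  "'a cset \<Rightarrow> bool \<Rightarrow> nat \<Rightarrow> 'a \<Rightarrow> ('a, bool list \<Rightarrow> bool list) gcell set" where
  "end_incl Z e k =
     (\<lambda>c\<in>cells Z k. gprod_class Z (representable 1) k (k, 0, c, face 0 1 e, ident k))"

text \<open>
  The last clause is the condition on \<open>{z} \<otimes> \<square>^1\<close>: the cubes of \<open>{z}\<close> are the degenerate cubes
  at \<open>z\<close>, so the image of \<open>{z} \<otimes> \<square>^1\<close> in \<open>Z \<otimes> \<square>^1\<close> consists of the classes displayed.
\<close>

definition pointed_homotopy ::
  "'a cset \<times> 'a \<Rightarrow> 'b cset \<times> 'b \<Rightarrow> (nat \<Rightarrow> 'a \<Rightarrow> 'b) \<Rightarrow> (nat \<Rightarrow> 'a \<Rightarrow> 'b) \<Rightarrow>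
   (nat \<Rightarrow> ('a, bool list \<Rightarrow> bool list) gcell set \<Rightarrow> 'b) \<Rightarrow> bool" where
  "pointed_homotopy = (\<lambda>(Z, z) (X, x) F G H.
     H \<in> maps (gprod Z (representable 1)) X \<and>
     (\<forall>k. \<forall>c\<in>cells Z k. H k (end_incl Z False k c) = F k c) \<and>
     (\<forall>k. \<forall>c\<in>cells Z k. H k (end_incl Z True k c) = G k c) \<and>
     (\<forall>k p q. \<forall>t\<in>Hom q 1. \<forall>f\<in>Hom k (p + q).
        H k (gprod_class Z (representable 1) k (p, q, const_cube Z z p, t, f)) = const_cube X x k))"

text \<open>
  Homotopy classes are taken with respect to the equivalence relation generated by pointed
  homotopy, so that they make sense for every target.
\<close>

definition homotopy_rel :: "'a cset \<times> 'a \<Rightarrow> 'b cset \<times> 'b \<Rightarrow> (nat \<Rightarrow> 'a \<Rightarrow> 'b) rel" where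
  "homotopy_rel A B = eq_closure (pointed_maps A B)
     {(F, G). F \<in> pointed_maps A B \<and> G \<in> pointed_maps A B \<and> (\<exists>H. pointed_homotopy A B F G H)}"

definition homotopy_classes :: "'a cset \<times> 'a \<Rightarrow> 'b cset \<times> 'b \<Rightarrow> (nat \<Rightarrow> 'a \<Rightarrow> 'b) set set" where
  "homotopy_classes A B = pointed_maps A B // homotopy_rel A B"


section \<open>Loop spaces and homotopy groups\<close>

text \<open>
  \<open>path_cset X\<close> is \<open>hom\<^sub>R(\<square>^1, X)\<close>: its \<open>k\<close>-cubes are the maps \<open>\<square>^1 \<otimes> \<square>^k = \<square>^(1+k) \<rightarrow> X\<close>, identified
  with \<open>(1+k)\<close>-cubes of \<open>X\<close> by the Yoneda lemma, and \<open>f\<close> acts on them as \<open>id \<otimes> f\<close>.  This identification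
  keeps the iterated loop spaces of \<open>X\<close> in the type of \<open>X\<close>.
\<close>

definition path_cset :: "'a cset \<Rightarrow> 'a cset" where
  "path_cset X =
     \<lparr>cells = (\<lambda>k. cells X (1 + k)),
      act = (\<lambda>j k f. act X (1 + j) (1 + k) (tens 1 j (ident 1) f))\<rparr>"

text \<open>
  The pullback of \<open>(x, x)\<close> along \<open>(\<partial>\<^sub>1\<^sub>,\<^sub>0\<^sup>*, \<partial>\<^sub>1\<^sub>,\<^sub>1\<^sup>*) : hom\<^sub>R(\<square>^1, X) \<rightarrow> X \<times> X\<close>, as a cubical subset of the
  path object.
\<close>

definition loop :: "'a cset \<times> 'a \<Rightarrow> 'a cset \<times> 'a" where
  "loop = (\<lambda>(X, x).
     ((path_cset X)
        \<lparr>cells := (\<lambda>k. {c \<in> cells (path_cset X) k.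
            act X k (1 + k) (face k 1 False) c = const_cube X x k \<and>
            act X k (1 + k) (face k 1 True) c = const_cube X x k})\<rparr>,
      act X 1 0 (degen 0 1) x))"

text \<open>\<open>\<pi>\<^sub>0\<close> is the colimit of \<open>X\<close> over the opposite of the cube category.\<close>

definition pi0_carrier :: "'a cset \<Rightarrow> (nat \<times> 'a) set" where
  "pi0_carrier X = (SIGMA n:UNIV. cells X n)"

definition pi0_rel :: "'a cset \<Rightarrow> (nat \<times> 'a) rel" where
  "pi0_rel X = eq_closure (pi0_carrier X)
     {((m, act X m n f c), (n, c)) | m n f c. f \<in> Hom m n \<and> c \<in> cells X n}"

definition pi0 :: "'a cset \<Rightarrow> (nat \<times> 'a) set set" where
  "pi0 X = pi0_carrier X // pi0_rel X"

definition loops :: "nat \<Rightarrow> 'a cset \<times> 'a \<Rightarrow> 'a cset" where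
  "loops n A = fst ((loop ^^ n) A)"

definition pi_n :: "nat \<Rightarrow> 'a cset \<times> 'a \<Rightarrow> (nat \<times> 'a) set set" where
  "pi_n n A = pi0 (loops n A)"

text \<open>
  The \<open>n\<close>-cube \<open>\<square>^n \<rightarrow> \<square>^n/\<partial>\<square>^n \<rightarrow> X\<close> of \<open>X\<close> given by \<open>F\<close>.  Since a \<open>k\<close>-cube of a loop space is
  literally a \<open>(k+1)\<close>-cube of the underlying cubical set, no conversion is needed to view it as
  a 0-cube of the \<open>n\<close>-th loop space.
\<close>

definition sphere_cube :: "nat \<Rightarrow> (nat \<Rightarrow> sphere_cell \<Rightarrow> 'a) \<Rightarrow> 'a" where
  "sphere_cube n F = F n (sphere_proj n n (ident n))"

end

theory Submission
  imports Defs
begin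

text \<open>
  A pointed map out of \<open>\<square>^n/\<partial>\<square>^n\<close> is an \<open>n\<close>-cube of \<open>X\<close> with faces degenerate at \<open>x\<close>.  Composed with
  \<open>\<square>^n \<otimes> \<square>^1 \<rightarrow> \<square>^n/\<partial>\<square>^n \<otimes> \<square>^1\<close>, a pointed homotopy becomes an \<open>(n + 1)\<close>-cube of \<open>X\<close> whose faces in the
  first \<open>n\<close> directions are degenerate at \<open>x\<close>, that is, a 1-cube of the \<open>n\<close>-th loop space; conversely
  such a cube descends to the quotient.  The elements of \<open>\<pi>\<^sub>0\<close> of any cubical set are the classes of
  its 0-cubes for the equivalence relation generated by the 1-cubes, because any two vertices of
  \<open>[1]^k\<close> are joined by a path of edges.  Hence the two generated equivalence relations correspond.
\<close>


section \<open>Morphisms of cubes\<close>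

lemma HomD:
  assumes "f \<in> Hom m n"
  shows Hom_cube: "v \<in> cube m \<Longrightarrow> f v \<in> cube n" and Hom_extensional: "f \<in> extensional (cube m)"
proof -
  have "(\<forall>v\<in>cube m. f v \<in> cube n) \<and> f \<in> extensional (cube m)" if "cube_mor m n f" for m n f
    using that
  proof induction
    case (comp l m g n f)
    then show ?case by (simp add: compose_eq)
  qed (auto simp: ident_def face_def degen_def conn_def extensional_def, auto simp: cube_def)
  with assms show "v \<in> cube m \<Longrightarrow> f v \<in> cube n" "f \<in> extensional (cube m)"
    by (auto simp: Hom_def)
qed

lemma Hom_length: "f \<in> Hom m n \<Longrightarrow> length v = m \<Longrightarrow> length (f v) = n"
  using Hom_cube[of f m n v] by (simp add: cube_def)

lemma ident_Hom [simp, intro]: "ident n \<in> Hom n n"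
  by (simp add: Hom_def cube_mor.ident)

lemma face_Hom [intro]: "1 \<le> i \<Longrightarrow> i \<le> n + 1 \<Longrightarrow> face n i e \<in> Hom n (n + 1)"
  unfolding Hom_def using cube_mor.face by blast

lemma compose_Hom [intro]: "g \<in> Hom l m \<Longrightarrow> f \<in> Hom m n \<Longrightarrow> compose (cube l) f g \<in> Hom l n"
  unfolding Hom_def using cube_mor.comp by blast

lemma compose_ident [simp]: "f \<in> Hom m n \<Longrightarrow> compose (cube m) f (ident m) = f"
  by (rule extensionalityI[OF compose_extensional Hom_extensional]) (auto simp: compose_eq ident_def)

lemma ident_compose [simp]: "f \<in> Hom m n \<Longrightarrow> compose (cube m) (ident n) f = f"
  by (rule extensionalityI[OF compose_extensional Hom_extensional])
    (auto simp: compose_eq ident_def Hom_cube)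

lemma compose_compose:
  assumes "g \<in> Hom l m"
  shows "compose (cube l) (compose (cube m) f h) g = compose (cube l) f (compose (cube l) h g)"
  by (rule extensionalityI[OF compose_extensional compose_extensional])
    (simp add: compose_eq Hom_cube[OF assms])

lemma Hom_0:
  assumes "f \<in> Hom k 0"
  shows "f = terminal k"
proof (rule extensionalityI[OF Hom_extensional[OF assms]])
  show "terminal k \<in> extensional (cube k)" by (simp add: terminal_def)
  show "f v = terminal k v" if "v \<in> cube k" for v
    using Hom_cube[OF assms that] that by (simp add: terminal_def cube_def)
qed

text \<open>Iterated degeneracies yield some morphism to the point, and uniqueness in
  \<open>Hom_0\<close> identifies it with \<open>terminal k\<close>, so the composite is never
  computed.\<close>

lemma terminal_Hom [simp, intro]: "terminal k \<in> Hom k 0"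
proof -
  have "\<exists>f. f \<in> Hom k 0"
  proof (induction k)
    case (Suc k)
    have "degen k 1 \<in> Hom (Suc k) k"
      using cube_mor.degen[of 1 k] by (simp add: Hom_def)
    with Suc show ?case by blast
  qed blast
  then show ?thesis using Hom_0 by metis
qed

section \<open>The monoidal structure of the cube category\<close>

lemma tens_append [simp]: "length a = m \<Longrightarrow> length b = n \<Longrightarrow> tens m n f g (a @ b) = f a @ g b"
  by (simp add: tens_def cube_def)

lemma tens_extensional [simp]: "tens m n f g \<in> extensional (cube (m + n))"
  by (simp add: tens_def)

text \<open>Every vector of length \<open>m + n\<close> splits as a concatenation, so identities
  between products reduce to computations with lists \<open>a @ b\<close>.\<close>

lemma tens_eqI:
  assumes "F \<in> extensional (cube (m + n))"
    and "\<And>a b. length a = m \<Longrightarrow> length b = n \<Longrightarrow> F (a @ b) = f a @ g b"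
  shows "tens m n f g = F"
proof (rule extensionalityI[OF tens_extensional assms(1)])
  fix v assume "v \<in> cube (m + n)"
  then have "length (take m v) = m" "length (drop m v) = n" by (auto simp: cube_def)
  then show "tens m n f g v = F v"
    by (metis append_take_drop_id assms(2) tens_append)
qed

lemma face_extensional [simp]: "face n i e \<in> extensional (cube n)"
  by (simp add: face_def)

lemma ident_apply [simp]: "length v = n \<Longrightarrow> ident n v = v"
  by (simp add: ident_def cube_def)

text \<open>This and the next five identities show that a generator tensored with an identity is
  again a generator: an identity on the left shifts the index by \<open>p\<close>, one on the right
  leaves it alone. They are the base cases of \<open>tens_Hom_left\<close> and
  \<open>tens_Hom_right\<close>.\<close>

lemma tens_ident_face:
  "1 \<le> i \<Longrightarrow> tens p n (ident p) (face n i e) = face (p + n) (p + i) e"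
  by (rule tens_eqI) (auto simp: face_def cube_def)

lemma tens_face_ident:
  "1 \<le> i \<Longrightarrow> i \<le> n + 1 \<Longrightarrow> tens n q (face n i e) (ident q) = face (n + q) i e"
  by (rule tens_eqI) (auto simp: face_def cube_def)

lemma tens_ident_degen:
  "1 \<le> i \<Longrightarrow> tens p (n + 1) (ident p) (degen n i) = degen (p + n) (p + i)"
  by (rule tens_eqI) (auto simp: degen_def cube_def)

lemma tens_degen_ident:
  "1 \<le> i \<Longrightarrow> i \<le> n + 1 \<Longrightarrow> tens (n + 1) q (degen n i) (ident q) = degen (n + q) i"
  by (rule tens_eqI) (auto simp: degen_def cube_def)

lemma tens_ident_conn:
  "1 \<le> i \<Longrightarrow> tens p (n + 1) (ident p) (conn n i e) = conn (p + n) (p + i) e"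
  by (rule tens_eqI) (auto simp: conn_def cube_def nth_append)

lemma tens_conn_ident:
  "1 \<le> i \<Longrightarrow> i \<le> n \<Longrightarrow> tens (n + 1) q (conn n i e) (ident q) = conn (n + q) i e"
  by (rule tens_eqI) (auto simp: conn_def cube_def nth_append)

lemma tens_ident: "tens m n (ident m) (ident n) = ident (m + n)"
  by (rule tens_eqI) (auto simp: ident_def cube_def)

lemma tens_compose:
  assumes "f' \<in> Hom l m" "g' \<in> Hom p q"
  shows "tens l p (compose (cube l) f f') (compose (cube p) g g') =
    compose (cube (l + p)) (tens m q f g) (tens l p f' g')"
  by (rule tens_eqI)
    (use assms in \<open>auto simp: compose_eq cube_def Hom_length\<close>)

lemma tens_assoc:
  assumes "f \<in> Hom l l'" "g \<in> Hom m m'" "h \<in> Hom n n'"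
  shows "tens l (m + n) f (tens m n g h) = tens (l + m) n (tens l m f g) h"
proof (rule tens_eqI)
  show "tens (l + m) n (tens l m f g) h \<in> extensional (cube (l + (m + n)))"
    by (metis add.assoc tens_extensional)
  fix a b :: "bool list" assume a: "length a = l" and b: "length b = m + n"
  define c d where "c = take m b" and "d = drop m b"
  then have "b = c @ d" "length c = m" "length d = n" using b by auto
  then show "tens (l + m) n (tens l m f g) h (a @ b) = f a @ tens m n g h b"
    using a tens_append[of "a @ c" "l + m" d n] by simp
qed

lemma tens_Hom_left:
  assumes "f \<in> Hom m n"
  shows "tens m q f (ident q) \<in> Hom (m + q) (n + q)"
proof -
  have "cube_mor (m + q) (n + q) (tens m q f (ident q))" if "cube_mor m n f" for m n f
    using that
  proof induction
    case (face i n e)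
    then show ?case using cube_mor.face[of i "n + q" e] by (simp add: tens_face_ident)
  next
    case (degen i n)
    then show ?case using cube_mor.degen[of i "n + q"] tens_degen_ident[of i n q] by simp
  next
    case (conn i n e)
    then show ?case using cube_mor.conn[of i "n + q" e] tens_conn_ident[of i n q e] by simp
  next
    case (comp l m g n f)
    \<comment> \<open>The interchange law \<open>tens_compose\<close>, with \<open>ident q\<close>
      read as its own square.\<close>
    have "tens l q (compose (cube l) f g) (ident q) =
        compose (cube (l + q)) (tens m q f (ident q)) (tens l q g (ident q))"
      using tens_compose[of g l m "ident q" q q f "ident q"] comp(1) compose_ident[OF ident_Hom]
      unfolding Hom_def mem_Collect_eq by (simp add: cube_mor.ident)
    then show ?case using cube_mor.comp[OF comp.IH] by simp
  qed (simp add: tens_ident cube_mor.ident)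
  with assms show ?thesis by (simp add: Hom_def)
qed

lemma tens_Hom_right:
  assumes "f \<in> Hom m n"
  shows "tens p m (ident p) f \<in> Hom (p + m) (p + n)"
proof -
  have "cube_mor (p + m) (p + n) (tens p m (ident p) f)" if "cube_mor m n f" for m n f
    using that
  proof induction
    case (face i n e)
    then show ?case using cube_mor.face[of "p + i" "p + n" e] by (simp add: tens_ident_face)
  next
    case (degen i n)
    then show ?case using cube_mor.degen[of "p + i" "p + n"] tens_ident_degen[of i p n] by simp
  next
    case (conn i n e)
    then show ?case using cube_mor.conn[of "p + i" "p + n" e] tens_ident_conn[of i p n e] by simp
  next
    case (comp l m g n f)
    have "tens p l (ident p) (compose (cube l) f g) =
        compose (cube (p + l)) (tens p m (ident p) f) (tens p l (ident p) g)"
      using tens_compose[of "ident p" p p g l m "ident p" f] comp(1) compose_ident[OF ident_Hom]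
      unfolding Hom_def mem_Collect_eq by (simp add: cube_mor.ident)
    then show ?case using cube_mor.comp[OF comp.IH] by simp
  qed (simp add: tens_ident cube_mor.ident)
  with assms show ?thesis by (simp add: Hom_def)
qed

text \<open>By interchange, \<open>f\<close> \<otimes> \<open>g\<close> is the composite of
  \<open>f\<close> \<otimes> id after id \<otimes> \<open>g\<close>, and both factors are already
  known to be morphisms.\<close>

lemma tens_Hom [intro]:
  assumes "f \<in> Hom m n" "g \<in> Hom p q"
  shows "tens m p f g \<in> Hom (m + p) (n + q)"
proof -
  have "tens m p f g = compose (cube (m + p)) (tens m q f (ident q)) (tens m p (ident m) g)"
    using tens_compose[of "ident m" m m g p q f "ident q"] assms by simp
  then show ?thesis
    using compose_Hom[OF tens_Hom_right[OF assms(2)] tens_Hom_left[OF assms(1)]] by simp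
qed


section \<open>Iterated loop spaces\<close>

lemma act_cells [intro]:
  "cubical_set X \<Longrightarrow> f \<in> Hom m n \<Longrightarrow> c \<in> cells X n \<Longrightarrow> act X m n f c \<in> cells X m"
  unfolding cubical_set_def by blast

lemma act_ident: "cubical_set X \<Longrightarrow> c \<in> cells X n \<Longrightarrow> act X n n (ident n) c = c"
  unfolding cubical_set_def by blast

lemma act_act:
  "cubical_set X \<Longrightarrow> g \<in> Hom l m \<Longrightarrow> f \<in> Hom m n \<Longrightarrow> c \<in> cells X n \<Longrightarrow>
    act X l m g (act X m n f c) = act X l n (compose (cube l) f g) c"
  unfolding cubical_set_def by metis

lemma const_cube_cells [intro]:
  "cubical_set X \<Longrightarrow> x \<in> cells X 0 \<Longrightarrow> const_cube X x k \<in> cells X k"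
  unfolding const_cube_def by blast

lemma act_const_cube:
  assumes "cubical_set X" "x \<in> cells X 0" "f \<in> Hom m n"
  shows "act X m n f (const_cube X x n) = const_cube X x m"
  unfolding const_cube_def
  using act_act[OF assms(1,3) terminal_Hom assms(2)] Hom_0[OF compose_Hom[OF assms(3) terminal_Hom]]
  by simp

lemma const_cube_0: "cubical_set X \<Longrightarrow> x \<in> cells X 0 \<Longrightarrow> const_cube X x 0 = x"
  unfolding const_cube_def using act_ident Hom_0[OF ident_Hom] by metis

text \<open>Closed form of the \<open>k\<close>-cubes of the \<open>n\<close>-th loop space,
  established in \<open>funpow_loop\<close>. The subtraction in \<open>n + k - 1\<close> truncates
  only for \<open>n = k = 0\<close>, where the face condition is vacuous.\<close>

definition loop_cells :: "'a cset \<Rightarrow> 'a \<Rightarrow> nat \<Rightarrow> nat \<Rightarrow> 'a set" where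
  "loop_cells X x n k = {c \<in> cells X (n + k). \<forall>i\<in>{1..n}. \<forall>e.
     act X (n + k - 1) (n + k) (face (n + k - 1) i e) c = const_cube X x (n + k - 1)}"

text \<open>Cells, action and base point are treated in one induction, since the cells of the next
  loop space are cut out by the action and the base point of the present one.\<close>

lemma funpow_loop:
  assumes X: "cubical_set X" "x \<in> cells X 0"
  shows "cells (fst ((loop ^^ n) (X, x))) k = loop_cells X x n k"
    and "f \<in> Hom j k \<Longrightarrow>
      act (fst ((loop ^^ n) (X, x))) j k f = act X (n + j) (n + k) (tens n j (ident n) f)"
    and "snd ((loop ^^ n) (X, x)) = const_cube X x n"
proof (induction n arbitrary: j k f)
  case 0
  {
    case 1
    show ?case by (simp add: loop_cells_def)
  next
    case 2
    have "tens 0 j (ident 0) f = f"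
      by (rule tens_eqI) (use Hom_extensional[OF 2] in auto)
    then show ?case by simp
  next
    case 3
    show ?case using const_cube_0[OF X] by simp
  }
next
  case (Suc n)
  obtain Y y where Y: "(loop ^^ n) (X, x) = (Y, y)" by fastforce
  have Suc_n: "(loop ^^ Suc n) (X, x) = loop (Y, y)" using Y by simp
  have cells: "cells Y k = loop_cells X x n k" for k using Suc.IH(1) Y by simp
  have act: "act Y j k f = act X (n + j) (n + k) (tens n j (ident n) f)" if "f \<in> Hom j k" for j k f
    using Suc.IH(2) that Y by simp
  have y: "y = const_cube X x n" using Suc.IH(3) Y by simp
  have const: "act Y k 0 f y = const_cube X x (n + k)" if "f \<in> Hom k 0" for k f
    using act_const_cube[OF X tens_Hom[OF ident_Hom that], of n]
    by (simp add: act[OF that] y)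
  \<comment> \<open>Direction 1 of the \<open>n\<close>-fold loop space is direction
    \<open>n + 1\<close> of \<open>X\<close>. Hence one more loop adds exactly the face conditions
    in direction \<open>Suc n\<close>.\<close>
  have face: "act Y k (Suc k) (face k 1 e) c = act X (n + k) (Suc n + k) (face (n + k) (Suc n) e) c"
    for k e c using act[OF face_Hom, of 1 k e] tens_ident_face[of 1 n k e] by simp
  {
    case 1
    have "cells (fst ((loop ^^ Suc n) (X, x))) k =
        {c \<in> loop_cells X x n (Suc k). \<forall>e.
          act X (n + k) (Suc n + k) (face (n + k) (Suc n) e) c = const_cube X x (n + k)}"
      using const[OF terminal_Hom, of k] face
      unfolding Suc_n by (simp add: loop_def path_cset_def cells const_cube_def all_bool_eq conj_commute)
    then show ?case
      by (auto simp: loop_cells_def atLeastAtMostSuc_conv)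
  next
    case 2
    have "act (fst ((loop ^^ Suc n) (X, x))) j k f =
        act X (n + (1 + j)) (n + (1 + k)) (tens n (1 + j) (ident n) (tens 1 j (ident 1) f))"
      using act[OF tens_Hom[OF ident_Hom 2], of 1] unfolding Suc_n by (simp add: loop_def path_cset_def)
    also have "tens n (1 + j) (ident n) (tens 1 j (ident 1) f) = tens (n + 1) j (ident (n + 1)) f"
      using tens_assoc[OF ident_Hom ident_Hom 2] tens_ident by metis
    finally show ?case by simp
  next
    case 3
    have "degen 0 1 \<in> Hom 1 0" using cube_mor.degen[of 1 0] by (simp add: Hom_def)
    then show ?case using const[of "degen 0 1" 1] unfolding Suc_n by (simp add: loop_def)
  }
qed

lemma cells_loops:
  "cubical_set X \<Longrightarrow> x \<in> cells X 0 \<Longrightarrow> cells (loops n (X, x)) k = loop_cells X x n k"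
  by (simp add: loops_def funpow_loop(1))

lemma act_loops:
  "cubical_set X \<Longrightarrow> x \<in> cells X 0 \<Longrightarrow> f \<in> Hom j k \<Longrightarrow>
    act (loops n (X, x)) j k f = act X (n + j) (n + k) (tens n j (ident n) f)"
  by (simp add: loops_def funpow_loop(2))

lemma face_tens_ident:
  assumes "1 \<le> i" "i \<le> n"
  shows "face (n + k - 1) i e = tens (n - 1) k (face (n - 1) i e) (ident k)"
  using tens_face_ident[of i "n - 1" k e] assms by simp

text \<open>Both sides equal \<open>face (n - 1) i e\<close> \<otimes> \<open>f\<close>, because the
  face and \<open>f\<close> concern disjoint blocks of coordinates. This is why operators on the
  last coordinates preserve the conditions in \<open>loop_cells\<close>.\<close>

lemma compose_tens_face:
  assumes "1 \<le> i" "i \<le> n" "f \<in> Hom j k"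
  shows "compose (cube (n + j - 1)) (tens n j (ident n) f) (face (n + j - 1) i e) =
    compose (cube (n + j - 1)) (face (n + k - 1) i e) (tens (n - 1) j (ident (n - 1)) f)"
proof -
  have *: "face (n - 1) i e \<in> Hom (n - 1) n" using face_Hom[of i "n - 1" e] assms by simp
  have n: "n + j - 1 = n - 1 + j" using assms by simp
  show ?thesis
    using face_tens_ident[OF assms(1,2), of j e] face_tens_ident[OF assms(1,2), of k e] tens_compose[OF * ident_Hom[of j], of "ident n" f]
      tens_compose[OF ident_Hom[of "n - 1"] assms(3), of "face (n - 1) i e" "ident k"] * assms(3)
    by (simp add: n[simplified])
qed

lemma cubical_set_loops:
  assumes X: "cubical_set X" "x \<in> cells X 0"
  shows "cubical_set (loops n (X, x))"
proof -
  have "act X (n + j) (n + k) (tens n j (ident n) f) c \<in> loop_cells X x n j"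
    if f: "f \<in> Hom j k" and c: "c \<in> loop_cells X x n k" for j k f c
  proof -
    have cX: "c \<in> cells X (n + k)" using c by (simp add: loop_cells_def)
    have "act X (n + j - 1) (n + j) (face (n + j - 1) i e)
        (act X (n + j) (n + k) (tens n j (ident n) f) c) = const_cube X x (n + j - 1)"
      if i: "1 \<le> i" "i \<le> n" for i e
    proof -
      have F: "face (n + l - 1) i e \<in> Hom (n + l - 1) (n + l)" for l
        using face_Hom[of i "n + l - 1" e] i by simp
      have T: "tens (n - 1) j (ident (n - 1)) f \<in> Hom (n + j - 1) (n + k - 1)"
        using tens_Hom[OF ident_Hom f, of "n - 1"] i by simp
      have "act X (n + j - 1) (n + j) (face (n + j - 1) i e)
          (act X (n + j) (n + k) (tens n j (ident n) f) c) =
          act X (n + j - 1) (n + k - 1) (tens (n - 1) j (ident (n - 1)) f)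
          (act X (n + k - 1) (n + k) (face (n + k - 1) i e) c)"
        by (simp only: act_act[OF X(1) F tens_Hom[OF ident_Hom f] cX] act_act[OF X(1) T F cX]
            compose_tens_face[OF i f])
      also have "\<dots> = const_cube X x (n + j - 1)"
        using c i act_const_cube[OF X T] by (simp add: loop_cells_def)
      finally show ?thesis .
    qed
    then show ?thesis using act_cells[OF X(1) tens_Hom[OF ident_Hom f] cX]
      by (auto simp: loop_cells_def)
  qed
  moreover have "act X (n + k) (n + k) (tens n k (ident n) (ident k)) c = c"
    if "c \<in> loop_cells X x n k" for k c
    using that act_ident[OF X(1)] by (simp add: loop_cells_def tens_ident)
  moreover have "act X (n + l) (n + k) (tens n l (ident n) (compose (cube l) f g)) c =
      act X (n + l) (n + j) (tens n l (ident n) g) (act X (n + j) (n + k) (tens n j (ident n) f) c)"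
    if "g \<in> Hom l j" "f \<in> Hom j k" "c \<in> loop_cells X x n k" for l j k f g c
    using that tens_compose[OF ident_Hom[of n] that(1), of "ident n" f]
    by (simp add: act_act[OF X(1)] loop_cells_def tens_Hom)
  ultimately show ?thesis
    unfolding cubical_set_def by (auto simp: cells_loops[OF X] act_loops[OF X] compose_Hom)
qed


section \<open>Generated equivalence relations and path components\<close>

lemma equiv_eq_closure: "equiv A (eq_closure A r)"
proof (rule equivI)
  have "sym ((r \<union> r\<inverse>)\<^sup>*)" by (intro sym_rtrancl) (auto intro: symI)
  then show "sym (eq_closure A r)" by (auto simp: eq_closure_def sym_def)
  show "trans (eq_closure A r)" by (auto simp: eq_closure_def trans_def)
qed (auto simp: eq_closure_def refl_on_def)

lemma eq_closure_gen: "(a, b) \<in> r \<Longrightarrow> a \<in> A \<Longrightarrow> b \<in> A \<Longrightarrow> (a, b) \<in> eq_closure A r"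
  by (auto simp: eq_closure_def)

text \<open>Induction along a zigzag of generators: reflexivity, symmetry and transitivity of
  \<open>s\<close> absorb its start, reversals and concatenation.\<close>

lemma eq_closure_map:
  assumes "(u, v) \<in> eq_closure A r" "r \<subseteq> A \<times> A" "equiv B s" "\<phi> \<in> A \<rightarrow> B"
    and gen: "\<And>a b. (a, b) \<in> r \<Longrightarrow> (\<phi> a, \<phi> b) \<in> s"
  shows "(\<phi> u, \<phi> v) \<in> s"
proof -
  have "u \<in> A" "(u, v) \<in> (r \<union> r\<inverse>)\<^sup>*" using assms(1) by (auto simp: eq_closure_def)
  from this(2) show ?thesis
  proof induction
    case base
    show ?case using assms(3,4) \<open>u \<in> A\<close> by (auto simp: equiv_def refl_on_def)
  next
    case (step v w)
    then have "(\<phi> v, \<phi> w) \<in> s" using gen assms(3) by (auto simp: equiv_def sym_def)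
    with step.IH show ?case using assms(3) by (auto simp: equiv_def trans_def)
  qed
qed

text \<open>The equivalence \<open>iff\<close> gives both well-definedness and injectivity.
  Surjectivity is asked only up to \<open>s\<close>, since the carrier of \<open>pi0\<close> also
  contains cubes of positive dimension.\<close>

lemma quotient_bij:
  assumes A: "equiv A r" and B: "equiv B s" and "\<phi> \<in> A \<rightarrow> B"
    and iff: "\<And>a b. a \<in> A \<Longrightarrow> b \<in> A \<Longrightarrow> (a, b) \<in> r \<longleftrightarrow> (\<phi> a, \<phi> b) \<in> s"
    and onto: "\<And>b. b \<in> B \<Longrightarrow> \<exists>a\<in>A. (\<phi> a, b) \<in> s"
  shows "\<exists>\<Psi>. bij_betw \<Psi> (A // r) (B // s) \<and> (\<forall>a\<in>A. \<Psi> (r `` {a}) = s `` {\<phi> a})"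
proof (intro exI conjI)
  \<comment> \<open>Saturating the image of a class avoids a choice of representatives.\<close>
  let ?\<Psi> = "\<lambda>S. s `` (\<phi> ` S)"
  have \<Psi>: "?\<Psi> (r `` {a}) = s `` {\<phi> a}" if "a \<in> A" for a
  proof
    show "?\<Psi> (r `` {a}) \<subseteq> s `` {\<phi> a}"
    proof
      fix z assume "z \<in> ?\<Psi> (r `` {a})"
      then obtain b where "(a, b) \<in> r" "(\<phi> b, z) \<in> s" by auto
      then show "z \<in> s `` {\<phi> a}"
        using iff[OF that] A B by (auto simp: equiv_def trans_def refl_on_def)
    qed
    show "s `` {\<phi> a} \<subseteq> ?\<Psi> (r `` {a})"
      using that A by (auto simp: equiv_def refl_on_def)
  qed
  then show "\<forall>a\<in>A. ?\<Psi> (r `` {a}) = s `` {\<phi> a}" by blast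
  show "bij_betw ?\<Psi> (A // r) (B // s)"
    unfolding bij_betw_def
  proof
    show "inj_on ?\<Psi> (A // r)"
    proof (rule inj_onI)
      fix S T assume "S \<in> A // r" "T \<in> A // r" and eq: "?\<Psi> S = ?\<Psi> T"
      then obtain a b where ab: "a \<in> A" "S = r `` {a}" "b \<in> A" "T = r `` {b}"
        by (auto elim!: quotientE)
      then have "(\<phi> a, \<phi> b) \<in> s"
        using eq \<Psi> eq_equiv_class[OF _ B, of "\<phi> a" "\<phi> b"] assms(3) by (auto simp: Pi_iff)
      then show "S = T" using ab iff equiv_class_eq[OF A] by blast
    qed
    show "?\<Psi> ` (A // r) = B // s"
    proof (intro subset_antisym image_subsetI subsetI)
      fix S assume "S \<in> A // r"
      then obtain a where a: "a \<in> A" "S = r `` {a}" by (rule quotientE)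
      have "s `` {\<phi> a} \<in> B // s" using a assms(3) by (intro quotientI) auto
      then show "?\<Psi> S \<in> B // s" unfolding a(2) \<Psi>[OF a(1)] .
    next
      fix T assume "T \<in> B // s"
      then obtain b where b: "b \<in> B" "T = s `` {b}" by (rule quotientE)
      obtain a where a: "a \<in> A" "(\<phi> a, b) \<in> s" using onto[OF b(1)] by blast
      then have "T = ?\<Psi> (r `` {a})"
        unfolding b(2) \<Psi>[OF a(1)] by (intro equiv_class_eq[OF B, symmetric])
      then show "T \<in> ?\<Psi> ` (A // r)" using quotientI[OF a(1)] by (rule image_eqI)
    qed
  qed
qed

section \<open>Path components from vertices and edges\<close>

definition vertex :: "bool list \<Rightarrow> bool list \<Rightarrow> bool list" where
  "vertex v = (\<lambda>_\<in>cube 0. v)"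

lemma Hom_0_eqI: "f \<in> Hom 0 k \<Longrightarrow> f [] = v \<Longrightarrow> f = vertex v"
  by (rule extensionalityI[OF Hom_extensional]) (auto simp: vertex_def cube_def)

text \<open>A vertex is assembled one coordinate at a time as a tensor product of the faces
  \<open>face 0 1 b\<close>.\<close>

lemma vertex_Hom [intro]: "vertex v \<in> Hom 0 (length v)"
proof (induction v)
  case Nil
  show ?case using terminal_Hom[of 0] Hom_0_eqI[of "terminal 0" 0]
    by (metis list.size(3) terminal_def vertex_def)
next
  case (Cons b v)
  have f: "face 0 1 b \<in> Hom 0 1" using face_Hom[of 1 0 b] by simp
  have "tens 0 0 (face 0 1 b) (vertex v) \<in> Hom 0 (length (b # v))"
    using tens_Hom[OF f Cons.IH] by simp
  moreover have "tens 0 0 (face 0 1 b) (vertex v) [] = b # v"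
    by (simp add: tens_def cube_def face_def vertex_def)
  ultimately show ?case by (metis Hom_0_eqI)
qed

definition edges :: "'a cset \<Rightarrow> 'a rel" where
  "edges Y = (\<lambda>d. (act Y 0 1 (face 0 1 False) d, act Y 0 1 (face 0 1 True) d)) ` cells Y 1"

lemma face_0_Hom [intro]: "face 0 1 e \<in> Hom 0 1"
  using face_Hom[of 1 0 e] by simp

lemma edges_subset: "cubical_set Y \<Longrightarrow> edges Y \<subseteq> cells Y 0 \<times> cells Y 0"
  by (auto simp: edges_def simp del: One_nat_def)

text \<open>The coordinates of \<open>u\<close> are changed into those of \<open>v\<close> from left
  to right. The prefix \<open>w\<close>, generalised in the induction, holds the coordinates already
  settled.\<close>

lemma vertices_connected:
  assumes Y: "cubical_set Y" and "length u = length v" and "c \<in> cells Y (length w + length u)"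
  shows "(act Y 0 (length w + length u) (vertex (w @ u)) c,
    act Y 0 (length w + length u) (vertex (w @ v)) c) \<in> eq_closure (cells Y 0) (edges Y)"
  using assms(2,3)
proof (induction u v arbitrary: w rule: list_induct2)
  case Nil
  then show ?case
    using vertex_Hom[of w] equiv_eq_closure[of "cells Y 0" "edges Y"] Y
    by (auto simp: equiv_def refl_on_def)
next
  case (Cons b u b' v)
  let ?n = "length w + length (b # u)"
  \<comment> \<open>The edge of the cube along which only the coordinate right after
    \<open>w\<close> varies.\<close>
  let ?g = "tens 0 1 (vertex w) (tens 1 0 (ident 1) (vertex u))"
  let ?r = "eq_closure (cells Y 0) (edges Y)"
  have g: "?g \<in> Hom 1 ?n"
    using tens_Hom[OF vertex_Hom[of w] tens_Hom[OF ident_Hom[of 1] vertex_Hom[of u]]] by simp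
  have ends: "compose (cube 0) ?g (face 0 1 e) = vertex (w @ e # u)" for e
  proof (rule Hom_0_eqI)
    show "compose (cube 0) ?g (face 0 1 e) \<in> Hom 0 ?n" using g by blast
    show "compose (cube 0) ?g (face 0 1 e) [] = w @ e # u"
      by (simp add: compose_eq face_def cube_def tens_def vertex_def)
  qed
  have eq: "act Y 0 1 (face 0 1 e) (act Y 1 ?n ?g c) = act Y 0 ?n (vertex (w @ e # u)) c" for e
    using act_act[OF Y face_0_Hom g Cons.prems] ends by simp
  have "(act Y 0 ?n (vertex (w @ False # u)) c, act Y 0 ?n (vertex (w @ True # u)) c) \<in> ?r"
    unfolding eq[symmetric] using Y g Cons.prems
    by (intro eq_closure_gen) (auto simp: edges_def simp del: One_nat_def)
  \<comment> \<open>According to \<open>b\<close> and \<open>b'\<close>, this is the edge, its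
    reverse, or reflexivity.\<close>
  then have "(act Y 0 ?n (vertex (w @ b # u)) c, act Y 0 ?n (vertex (w @ b' # u)) c) \<in> ?r"
    using equiv_eq_closure[of "cells Y 0" "edges Y"]
    by (cases b; cases b') (auto simp: equiv_def sym_def refl_on_def eq_closure_def)
  moreover have "(act Y 0 ?n (vertex (w @ b' # u)) c, act Y 0 ?n (vertex (w @ b' # v)) c) \<in> ?r"
    using Cons.IH[of "w @ [b']"] Cons.prems by simp
  ultimately show ?case
    using equiv_eq_closure[of "cells Y 0" "edges Y"] by (metis equivE transE)
qed

lemma pi0_rel_gen:
  assumes "cubical_set Y" "f \<in> Hom m n" "c \<in> cells Y n"
  shows "((m, act Y m n f c), (n, c)) \<in> pi0_rel Y"
  unfolding pi0_rel_def using assms by (intro eq_closure_gen) (auto simp: pi0_carrier_def)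

text \<open>Zigzags in the colimit pass through cubes of all dimensions. Replacing each cube by one
  of its vertices turns them into edge paths; conversely, both ends of an edge are identified with
  the edge itself.\<close>

lemma pi0_rel_vertices:
  assumes Y: "cubical_set Y" and "a \<in> cells Y 0" "b \<in> cells Y 0"
  shows "((0, a), (0, b)) \<in> pi0_rel Y \<longleftrightarrow> (a, b) \<in> eq_closure (cells Y 0) (edges Y)"
proof
  assume *: "((0, a), (0, b)) \<in> pi0_rel Y"
  \<comment> \<open>The initial vertex of a cube. A morphism \<open>f\<close> need not preserve
    initial vertices, but \<open>f (replicate m False)\<close> and \<open>replicate n False\<close>
    are both vertices of the same cube \<open>c\<close>, so \<open>vertices_connected\<close>
    applies.\<close>
  define \<phi> where "\<phi> = (\<lambda>(k, c). act Y 0 k (vertex (replicate k False)) c)"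
  have v: "vertex (replicate k False) \<in> Hom 0 k" for k
    using vertex_Hom[of "replicate k False"] by simp
  have "(\<phi> (0, a), \<phi> (0, b)) \<in> eq_closure (cells Y 0) (edges Y)"
  proof (rule eq_closure_map[OF *[unfolded pi0_rel_def] _ equiv_eq_closure])
    show "\<phi> \<in> pi0_carrier Y \<rightarrow> cells Y 0" using Y v by (auto simp: \<phi>_def pi0_carrier_def)
    fix p q assume "(p, q) \<in> {((m, act Y m n f c), (n, c)) | m n f c. f \<in> Hom m n \<and> c \<in> cells Y n}"
    then obtain m n f c where pq: "p = (m, act Y m n f c)" "q = (n, c)" "f \<in> Hom m n" "c \<in> cells Y n"
      by blast
    let ?u = "f (replicate m False)"
    have "compose (cube 0) f (vertex (replicate m False)) = vertex ?u"
      by (rule Hom_0_eqI[OF compose_Hom[OF v pq(3)]]) (simp add: compose_eq cube_def vertex_def)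
    then have "\<phi> p = act Y 0 n (vertex ?u) c"
      using act_act[OF Y v pq(3,4)] by (simp add: \<phi>_def pq)
    moreover have "length ?u = n" by (rule Hom_length[OF pq(3)]) simp
    ultimately show "(\<phi> p, \<phi> q) \<in> eq_closure (cells Y 0) (edges Y)"
      using vertices_connected[OF Y, of ?u "replicate n False" c "[]"] pq by (simp add: \<phi>_def)
  qed (use Y in \<open>auto simp: pi0_carrier_def\<close>)
  moreover have "\<phi> (0, c) = c" if "c \<in> cells Y 0" for c
    using act_ident[OF Y that] by (simp add: \<phi>_def vertex_def ident_def cube_def restrict_def cong: if_cong)
  ultimately show "(a, b) \<in> eq_closure (cells Y 0) (edges Y)" using assms by simp
next
  assume *: "(a, b) \<in> eq_closure (cells Y 0) (edges Y)"
  have equiv: "equiv (pi0_carrier Y) (pi0_rel Y)" unfolding pi0_rel_def by (rule equiv_eq_closure)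
  show "((0, a), (0, b)) \<in> pi0_rel Y"
  proof (rule eq_closure_map[OF * edges_subset[OF Y] equiv])
    fix p q assume "(p, q) \<in> edges Y"
    then obtain d where d: "d \<in> cells Y 1" "p = act Y 0 1 (face 0 1 False) d"
      "q = act Y 0 1 (face 0 1 True) d" by (auto simp: edges_def)
    then show "((0, p), (0, q)) \<in> pi0_rel Y"
      using pi0_rel_gen[OF Y face_0_Hom d(1)] equiv by (metis equivE symE transE)
  qed (auto simp: pi0_carrier_def)
qed

lemma pi0_rel_vertex_exists:
  assumes "cubical_set Y" "p \<in> pi0_carrier Y"
  shows "\<exists>a\<in>cells Y 0. ((0, a), p) \<in> pi0_rel Y"
proof -
  obtain k c where "p = (k, c)" "c \<in> cells Y k" using assms by (auto simp: pi0_carrier_def)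
  then show ?thesis
    using pi0_rel_gen[OF assms(1) _, of "vertex (replicate k False)" 0 k c]
      vertex_Hom[of "replicate k False"] act_cells[OF assms(1)] by fastforce
qed


section \<open>Quotients of cubical sets\<close>

text \<open>Common framework for the pushout defining the sphere and the coend defining the
  geometric product. \<open>R\<close> holds only generating pairs, and these must be stable under
  the operators.\<close>

locale cubical_quotient =
  fixes P :: "'a cset" and R :: "nat \<Rightarrow> 'a rel"
  assumes act_P: "f \<in> Hom m n \<Longrightarrow> u \<in> cells P n \<Longrightarrow> act P m n f u \<in> cells P m"
    and R_subset: "R m \<subseteq> cells P m \<times> cells P m"
    and R_act: "f \<in> Hom m n \<Longrightarrow> (u, v) \<in> R n \<Longrightarrow> (act P m n f u, act P m n f v) \<in> R m"
begin

abbreviation cls :: "nat \<Rightarrow> 'a \<Rightarrow> 'a set" where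
  "cls m u \<equiv> quot_rel P R m `` {u}"

lemma equiv_quot_rel: "equiv (cells P m) (quot_rel P R m)"
  unfolding quot_rel_def by (rule equiv_eq_closure)

lemma cells_quot: "cells (quot_cset P R) m = cls m ` cells P m"
  by (auto simp: quot_cset_def quotient_def)

lemma cls_self: "u \<in> cells P m \<Longrightarrow> u \<in> cls m u"
  by (rule equiv_class_self[OF equiv_quot_rel])

lemma cls_eq: "(u, v) \<in> R m \<Longrightarrow> cls m u = cls m v"
  using R_subset by (intro equiv_class_eq[OF equiv_quot_rel]) (auto simp: quot_rel_def intro!: eq_closure_gen)

text \<open>An operator carries a zigzag of generators to a zigzag of generators, so all members of
  a class are sent into one class and the union in \<open>quot_cset\<close> is a single
  class.\<close>

lemma act_cls:
  assumes f: "f \<in> Hom m n" and u: "u \<in> cells P n"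
  shows "act (quot_cset P R) m n f (cls n u) = cls m (act P m n f u)"
proof -
  have *: "(act P m n f u, act P m n f v) \<in> quot_rel P R m" if "v \<in> cls n u" for v
  proof (rule eq_closure_map[OF _ R_subset equiv_quot_rel, where \<phi> = "act P m n f"])
    show "(u, v) \<in> eq_closure (cells P n) (R n)" using that by (simp add: quot_rel_def)
    show "(act P m n f a, act P m n f b) \<in> quot_rel P R m" if "(a, b) \<in> R n" for a b
      using R_act[OF f that] R_subset[of m] by (auto simp: quot_rel_def intro!: eq_closure_gen)
  qed (use act_P[OF f] in blast)
  have "cls m (act P m n f v) = cls m (act P m n f u)" if "v \<in> cls n u" for v
    using equiv_class_eq[OF equiv_quot_rel *[OF that]] by simp
  then have "(\<Union>v\<in>cls n u. cls m (act P m n f v)) = cls m (act P m n f u)"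
    by (intro UN_constant_eq[OF cls_self[OF u]] ballI)
  moreover have "act (quot_cset P R) m n f (cls n u) = (\<Union>v\<in>cls n u. cls m (act P m n f v))"
    by (simp add: quot_cset_def) blast
  ultimately show ?thesis by simp
qed

text \<open>The universal property of the quotient in one dimension: a function constant on
  generating pairs is constant on each class, so its image is a singleton and
  \<open>the_elem\<close> reads off the value.\<close>

lemma the_elem_image_cls:
  assumes "\<And>u v. (u, v) \<in> R m \<Longrightarrow> \<phi> u = \<phi> v" and "u \<in> cells P m"
  shows "the_elem (\<phi> ` cls m u) = \<phi> u"
proof -
  \<comment> \<open>Equality serves as the target equivalence relation in
    \<open>eq_closure_map\<close>.\<close>
  have "(\<phi> u, \<phi> v) \<in> Id" if "v \<in> cls m u" for v
    by (rule eq_closure_map[OF _ R_subset, where B = UNIV])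
      (use that assms(1) in \<open>auto simp: quot_rel_def equiv_def refl_on_def sym_def trans_def\<close>)
  then have "{\<phi> v} = {\<phi> u}" if "v \<in> cls m u" for v
    using that by (metis pair_in_Id_conv)
  then have "(\<Union>v\<in>cls m u. {\<phi> v}) = {\<phi> u}"
    by (intro UN_constant_eq[OF cls_self[OF assms(2)]] ballI)
  then show ?thesis by (simp add: UNION_singleton_eq_range)
qed

end


section \<open>The cubical sphere\<close>

lemma cubical_set_representable: "cubical_set (representable n)"
  unfolding cubical_set_def by (auto simp: representable_def compose_compose)

lemma boundaryE:
  assumes "c \<in> cells (boundary n) m"
  obtains i e h where "1 \<le> i" "i \<le> n" "h \<in> Hom m (n - 1)" "c = compose (cube m) (face (n - 1) i e) h"
    "face (n - 1) i e \<in> Hom (n - 1) n"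
proof -
  obtain i e h where *: "1 \<le> i" "i \<le> n" "h \<in> Hom m (n - 1)"
    "c = compose (cube m) (face (n - 1) i e) h"
    using assms unfolding boundary_def face_union_def representable_def by auto
  then show thesis using that face_Hom[of i "n - 1" e] by simp
qed

lemma boundaryI:
  "1 \<le> i \<Longrightarrow> i \<le> n \<Longrightarrow> h \<in> Hom m (n - 1) \<Longrightarrow>
    compose (cube m) (face (n - 1) i e) h \<in> cells (boundary n) m"
  unfolding boundary_def face_union_def representable_def by fastforce

lemma face_boundary:
  assumes "1 \<le> i" "i \<le> n"
  shows "face (n - 1) i e \<in> cells (boundary n) (n - 1)"
  using boundaryI[OF assms ident_Hom, of e] compose_ident[of "face (n - 1) i e" "n - 1" n]
    face_Hom[of i "n - 1" e] assms by simp

lemma boundary_Hom: "c \<in> cells (boundary n) m \<Longrightarrow> c \<in> Hom m n"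
  by (auto elim!: boundaryE)

lemma boundary_compose:
  assumes "c \<in> cells (boundary n) m" "f \<in> Hom k m"
  shows "compose (cube k) c f \<in> cells (boundary n) k"
  using assms(1)
proof (rule boundaryE)
  fix i e h assume *: "1 \<le> i" "i \<le> n" "h \<in> Hom m (n - 1)" "c = compose (cube m) (face (n - 1) i e) h"
  then show ?thesis
    using boundaryI[OF *(1,2) compose_Hom[OF assms(2) *(3)]] by (simp add: compose_compose[OF assms(2)])
qed

abbreviation sphere_pre :: "nat \<Rightarrow> ((bool list \<Rightarrow> bool list) + (bool list \<Rightarrow> bool list)) cset" where
  "sphere_pre n \<equiv> coproduct (representable n) (representable 0)"

abbreviation sphere_gen ::
  "nat \<Rightarrow> nat \<Rightarrow> ((bool list \<Rightarrow> bool list) + (bool list \<Rightarrow> bool list)) rel" where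
  "sphere_gen n \<equiv> pushout_gen (boundary n) (boundary_incl n) (boundary_collapse n)"

lemma sphere_gen: "sphere_gen n m = {(Inl c, Inr (terminal m)) | c. c \<in> cells (boundary n) m}"
  by (auto simp: pushout_gen_def boundary_incl_def boundary_collapse_def)

interpretation sphere: cubical_quotient "sphere_pre n" "sphere_gen n" for n
proof
  show "sphere_gen n m \<subseteq> cells (sphere_pre n) m \<times> cells (sphere_pre n) m" for m
    by (auto simp: sphere_gen coproduct_def representable_def boundary_Hom)
next
  fix f m k u v assume f: "f \<in> Hom m k" and "(u, v) \<in> sphere_gen n k"
  then obtain c where "u = Inl c" "v = Inr (terminal k)" "c \<in> cells (boundary n) k"
    by (auto simp: sphere_gen)
  then show "(act (sphere_pre n) m k f u, act (sphere_pre n) m k f v) \<in> sphere_gen n m"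
    using boundary_compose[OF _ f] Hom_0[OF compose_Hom[OF f terminal_Hom]]
    by (simp add: sphere_gen coproduct_def representable_def)
qed (auto simp: coproduct_def representable_def)

abbreviation sphere_base :: "nat \<Rightarrow> nat \<Rightarrow> sphere_cell" where
  "sphere_base n m \<equiv> const_cube (sphere n) (sphere_pt n) m"

lemma sphere_alt: "sphere n = quot_cset (sphere_pre n) (sphere_gen n)"
  by (simp add: sphere_def pushout_def)

lemma sphere_proj_alt: "h \<in> Hom m n \<Longrightarrow> sphere_proj n m h = sphere.cls n m (Inl h)"
  by (simp add: sphere_proj_def pushout_inl_def representable_def)

lemma sphere_pre_Inr: "Inr (terminal m) \<in> cells (sphere_pre n) m"
  by (auto simp: coproduct_def representable_def)

lemma sphere_pre_Inl: "h \<in> Hom m n \<Longrightarrow> Inl h \<in> cells (sphere_pre n) m"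
  by (auto simp: coproduct_def representable_def)

lemma sphere_act_Inr:
  assumes "f \<in> Hom m k"
  shows "act (sphere n) m k f (sphere.cls n k (Inr (terminal k))) = sphere.cls n m (Inr (terminal m))"
  using sphere.act_cls[OF assms sphere_pre_Inr] Hom_0[OF compose_Hom[OF assms terminal_Hom]]
  by (simp add: sphere_alt coproduct_def representable_def)

lemma sphere_pt_alt: "sphere_pt n = sphere.cls n 0 (Inr (terminal 0))"
  using Hom_0[OF ident_Hom] by (simp add: sphere_pt_def pushout_inr_def representable_def)

lemma sphere_base_alt: "sphere_base n m = sphere.cls n m (Inr (terminal m))"
  using sphere_act_Inr[OF terminal_Hom] by (simp add: const_cube_def sphere_pt_alt)

lemma sphere_base_0: "sphere_base n 0 = sphere_pt n"
  by (rule trans[OF sphere_base_alt sphere_pt_alt[symmetric]])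

lemma sphere_act_base: "f \<in> Hom m k \<Longrightarrow> act (sphere n) m k f (sphere_base n k) = sphere_base n m"
  using sphere_act_Inr by (simp add: sphere_base_alt)

lemma sphere_act_proj:
  assumes "f \<in> Hom m k" "h \<in> Hom k n"
  shows "act (sphere n) m k f (sphere_proj n k h) = sphere_proj n m (compose (cube m) h f)"
  using sphere.act_cls[OF assms(1) sphere_pre_Inl[OF assms(2)]] assms
  by (simp add: sphere_proj_alt compose_Hom sphere_alt coproduct_def representable_def)

lemma sphere_proj_boundary: "c \<in> cells (boundary n) m \<Longrightarrow> sphere_proj n m c = sphere_base n m"
  using sphere.cls_eq[of "Inl c" "Inr (terminal m)" n m]
  by (simp add: sphere_proj_alt boundary_Hom sphere_base_alt sphere_gen)

text \<open>\<open>representable 0\<close> has one cell in each dimension, hence a single base cell.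
  The two kinds of cells overlap exactly where boundary cells are collapsed, so values given on both
  must agree there.\<close>

lemma cells_sphere: "cells (sphere n) m = insert (sphere_base n m) (sphere_proj n m ` Hom m n)"
proof -
  have "cells (sphere_pre n) m = insert (Inr (terminal m)) (Inl ` Hom m n)"
    using Hom_0[of _ m] by (auto simp: coproduct_def representable_def)
  then show ?thesis
    by (simp add: sphere_alt sphere.cells_quot sphere_base_alt[unfolded sphere_alt] image_image
        sphere_proj_alt cong: image_cong_simp)
qed

lemma sphere_cases:
  assumes "S \<in> cells (sphere n) m"
  obtains (base) "S = sphere_base n m" | (proj) h where "h \<in> Hom m n" "S = sphere_proj n m h"
  using assms by (auto simp: cells_sphere)

lemma sphere_proj_cells: "h \<in> Hom m n \<Longrightarrow> sphere_proj n m h \<in> cells (sphere n) m"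
  by (simp add: cells_sphere)

lemma sphere_base_cells: "sphere_base n m \<in> cells (sphere n) m"
  by (simp add: cells_sphere)

lemma cubical_set_sphere: "cubical_set (sphere n)"
  unfolding cubical_set_def
proof (intro conjI allI ballI funcsetI)
  fix m k f S assume f: "f \<in> Hom m k" and "S \<in> cells (sphere n) k"
  from this(2) show "act (sphere n) m k f S \<in> cells (sphere n) m"
    by (cases rule: sphere_cases)
      (use f in \<open>auto simp: sphere_act_base sphere_act_proj sphere_base_cells intro!: sphere_proj_cells\<close>)
next
  fix k S assume "S \<in> cells (sphere n) k"
  then show "act (sphere n) k k (ident k) S = S"
    by (cases rule: sphere_cases) (auto simp: sphere_act_base sphere_act_proj)
next
  fix l m k g f S assume *: "g \<in> Hom l m" "f \<in> Hom m k" and "S \<in> cells (sphere n) k"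
  from this(3) show "act (sphere n) l k (compose (cube l) f g) S =
      act (sphere n) l m g (act (sphere n) m k f S)"
    by (cases rule: sphere_cases)
      (use * in \<open>auto simp: sphere_act_base sphere_act_proj compose_Hom compose_compose\<close>)
qed

text \<open>The map out of the pushout in a fixed dimension, with \<alpha> prescribed on the cube
  and \<open>y\<close> on the point; it is meaningful when \<alpha> takes the value \<open>y\<close>
  on the boundary.\<close>

definition sphere_lift :: "((bool list \<Rightarrow> bool list) \<Rightarrow> 'b) \<Rightarrow> 'b \<Rightarrow> sphere_cell \<Rightarrow> 'b" where
  "sphere_lift \<alpha> y S = the_elem (case_sum \<alpha> (\<lambda>_. y) ` S)"

lemma sphere_lift:
  assumes "\<And>c. c \<in> cells (boundary n) m \<Longrightarrow> \<alpha> c = y"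
  shows sphere_lift_proj: "h \<in> Hom m n \<Longrightarrow> sphere_lift \<alpha> y (sphere_proj n m h) = \<alpha> h"
    and sphere_lift_base: "sphere_lift \<alpha> y (sphere_base n m) = y"
proof -
  have *: "the_elem (case_sum \<alpha> (\<lambda>_. y) ` sphere.cls n m u) = case_sum \<alpha> (\<lambda>_. y) u"
    if "u \<in> cells (sphere_pre n) m" for u
    by (rule sphere.the_elem_image_cls[OF _ that]) (auto simp: sphere_gen assms)
  show "h \<in> Hom m n \<Longrightarrow> sphere_lift \<alpha> y (sphere_proj n m h) = \<alpha> h"
    using *[OF sphere_pre_Inl] by (simp add: sphere_lift_def sphere_proj_alt)
  show "sphere_lift \<alpha> y (sphere_base n m) = y"
    using *[OF sphere_pre_Inr] by (simp add: sphere_lift_def sphere_base_alt)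
qed


section \<open>The geometric product\<close>

locale geometric_product =
  fixes Z :: "'a cset" and Y :: "'b cset"
  assumes Z: "cubical_set Z" and Y: "cubical_set Y"
begin

sublocale cubical_quotient "gprod_pre Z Y" "gprod_gen Z Y"
proof
  fix f m n u assume "f \<in> Hom m n" "u \<in> cells (gprod_pre Z Y) n"
  then show "act (gprod_pre Z Y) m n f u \<in> cells (gprod_pre Z Y) m"
    by (auto simp: gprod_pre_def)
next
  show "gprod_gen Z Y m \<subseteq> cells (gprod_pre Z Y) m \<times> cells (gprod_pre Z Y) m" for m
    using act_cells[OF Z] act_cells[OF Y] by (auto simp: gprod_pre_def gprod_gen_def)
next
  fix f m n u v assume f: "f \<in> Hom m n" and "(u, v) \<in> gprod_gen Z Y n"
  then obtain p p' q q' a b c d g where *: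
    "u = (p', q', act Z p' p a c, act Y q' q b d, g)"
    "v = (p, q, c, d, compose (cube n) (tens p' q' a b) g)"
    "a \<in> Hom p' p" "b \<in> Hom q' q" "c \<in> cells Z p" "d \<in> cells Y q" "g \<in> Hom n (p' + q')"
    by (auto simp: gprod_gen_def)
  have "compose (cube m) g f \<in> Hom m (p' + q')" using f *(7) by blast
  then show "(act (gprod_pre Z Y) m n f u, act (gprod_pre Z Y) m n f v) \<in> gprod_gen Z Y m"
    using *(3-6) by (fastforce simp: *(1,2) gprod_pre_def gprod_gen_def compose_compose[OF f])
qed

lemma cells_gprod: "cells (gprod Z Y) k = gprod_class Z Y k ` cells (gprod_pre Z Y) k"
  by (simp add: gprod_def cells_quot gprod_class_def[abs_def])

lemma gprod_class_eq:
  assumes "a \<in> Hom p' p" "b \<in> Hom q' q" "c \<in> cells Z p" "d \<in> cells Y q" "f \<in> Hom k (p' + q')"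
  shows "gprod_class Z Y k (p', q', act Z p' p a c, act Y q' q b d, f) =
    gprod_class Z Y k (p, q, c, d, compose (cube k) (tens p' q' a b) f)"
  unfolding gprod_class_def by (rule cls_eq) (use assms in \<open>auto simp: gprod_gen_def\<close>)

lemma gprod_class_cells:
  "c \<in> cells Z p \<Longrightarrow> d \<in> cells Y q \<Longrightarrow> f \<in> Hom k (p + q) \<Longrightarrow>
    gprod_class Z Y k (p, q, c, d, f) \<in> cells (gprod Z Y) k"
  unfolding cells_gprod by (rule imageI) (simp add: gprod_pre_def)

lemma act_gprod:
  assumes "c \<in> cells Z p" "d \<in> cells Y q" "f \<in> Hom k (p + q)" "g \<in> Hom j k"
  shows "act (gprod Z Y) j k g (gprod_class Z Y k (p, q, c, d, f)) =
    gprod_class Z Y j (p, q, c, d, compose (cube j) f g)"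
  using act_cls[OF assms(4), of "(p, q, c, d, f)"] assms
  by (simp add: gprod_class_def gprod_def gprod_pre_def)

text \<open>Existence half of the universal property of the coend. The value on the class of
  \<open>(p, q, c, d, f)\<close> is the restriction of \<open>\<Phi> p q c d\<close> along
  \<open>f\<close>, and naturality makes it independent of the representative.\<close>

lemma gprod_map_exists:
  assumes X: "cubical_set X"
    and \<Phi>: "\<And>p q c d. c \<in> cells Z p \<Longrightarrow> d \<in> cells Y q \<Longrightarrow> \<Phi> p q c d \<in> cells X (p + q)"
    and natural: "\<And>p' p q' q a b c d. a \<in> Hom p' p \<Longrightarrow> b \<in> Hom q' q \<Longrightarrow> c \<in> cells Z p \<Longrightarrow>
      d \<in> cells Y q \<Longrightarrow> \<Phi> p' q' (act Z p' p a c) (act Y q' q b d) =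
        act X (p' + q') (p + q) (tens p' q' a b) (\<Phi> p q c d)"
  shows "\<exists>H\<in>maps (gprod Z Y) X. \<forall>k p q. \<forall>c\<in>cells Z p. \<forall>d\<in>cells Y q. \<forall>f\<in>Hom k (p + q).
    H k (gprod_class Z Y k (p, q, c, d, f)) = act X k (p + q) f (\<Phi> p q c d)"
proof -
  define \<phi> where "\<phi> k = (\<lambda>(p, q, c, d, f). act X k (p + q) f (\<Phi> p q c d))" for k
  define H where "H k = (\<lambda>S\<in>cells (gprod Z Y) k. the_elem (\<phi> k ` S))" for k
  have H: "H k (gprod_class Z Y k u) = \<phi> k u" if u: "u \<in> cells (gprod_pre Z Y) k" for k u
  proof -
    have "the_elem (\<phi> k ` cls k u) = \<phi> k u"
    proof (rule the_elem_image_cls[OF _ u])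
      fix u v assume "(u, v) \<in> gprod_gen Z Y k"
      then obtain p p' q q' a b c d g where *:
        "u = (p', q', act Z p' p a c, act Y q' q b d, g)"
        "v = (p, q, c, d, compose (cube k) (tens p' q' a b) g)"
        "a \<in> Hom p' p" "b \<in> Hom q' q" "c \<in> cells Z p" "d \<in> cells Y q" "g \<in> Hom k (p' + q')"
        by (auto simp: gprod_gen_def)
      then show "\<phi> k u = \<phi> k v"
        by (simp add: \<phi>_def natural act_act[OF X] tens_Hom \<Phi>)
    qed
    then show ?thesis using u by (simp add: H_def gprod_class_def cells_gprod)
  qed
  have "H \<in> maps (gprod Z Y) X"
    unfolding maps_def
  proof (intro CollectI conjI allI ballI PiE_I)
    fix k S assume "S \<in> cells (gprod Z Y) k"
    then obtain p q c d f where *: "S = gprod_class Z Y k (p, q, c, d, f)" "c \<in> cells Z p"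
      "d \<in> cells Y q" "f \<in> Hom k (p + q)"
      by (auto simp: cells_gprod gprod_pre_def)
    then show "H k S \<in> cells X k" using X \<Phi> by (auto simp: H gprod_pre_def \<phi>_def)
  next
    fix m k f S assume f: "f \<in> Hom m k" and "S \<in> cells (gprod Z Y) k"
    then obtain p q c d g where *: "S = gprod_class Z Y k (p, q, c, d, g)" "c \<in> cells Z p"
      "d \<in> cells Y q" "g \<in> Hom k (p + q)"
      by (auto simp: cells_gprod gprod_pre_def)
    then show "H m (act (gprod Z Y) m k f S) = act X m k f (H k S)"
      using f compose_Hom[OF f *(4)]
      by (simp add: act_gprod H gprod_pre_def \<phi>_def act_act[OF X] \<Phi>)
  qed (simp add: H_def)
  moreover have "H k (gprod_class Z Y k (p, q, c, d, f)) = act X k (p + q) f (\<Phi> p q c d)"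
    if "c \<in> cells Z p" "d \<in> cells Y q" "f \<in> Hom k (p + q)" for k p q c d f
    using H[of "(p, q, c, d, f)" k] that by (simp add: gprod_pre_def \<phi>_def)
  ultimately show ?thesis by blast
qed

end


section \<open>Pointed maps out of the sphere\<close>

text \<open>A boundary cell \<open>h\<close> factors as a face after some \<open>g\<close>, so
  \<open>h\<close> \<otimes> \<open>t\<close> factors through the corresponding face of
  \<open>w\<close>, which is constant. This lets \<open>w\<close> descend to the sphere;
  \<open>k = 0\<close> serves maps and \<open>k = 1\<close> homotopies.\<close>

lemma loop_cells_boundary:
  assumes X: "cubical_set X" "x \<in> cells X 0" and w: "w \<in> loop_cells X x n k"
    and h: "h \<in> cells (boundary n) p" and t: "t \<in> Hom q k"
  shows "act X (p + q) (n + k) (tens p q h t) w = const_cube X x (p + q)"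
  using h
proof (rule boundaryE)
  fix i e g assume i: "1 \<le> i" "i \<le> n" and g: "g \<in> Hom p (n - 1)"
    and h_eq: "h = compose (cube p) (face (n - 1) i e) g"
    and f: "face (n - 1) i e \<in> Hom (n - 1) n"
  let ?f = "face (n + k - 1) i e"
  have F: "?f \<in> Hom (n + k - 1) (n + k)" using face_Hom[of i "n + k - 1" e] i by simp
  have G: "tens p q g t \<in> Hom (p + q) (n + k - 1)" using tens_Hom[OF g t] i by simp
  have wX: "w \<in> cells X (n + k)" using w by (simp add: loop_cells_def)
  have "tens p q h t = compose (cube (p + q)) ?f (tens p q g t)"
    using tens_compose[OF g t, of "face (n - 1) i e" "ident k"] t
    by (simp only: h_eq ident_compose face_tens_ident[OF i])
  then have "act X (p + q) (n + k) (tens p q h t) w =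
      act X (p + q) (n + k - 1) (tens p q g t) (act X (n + k - 1) (n + k) ?f w)"
    by (simp only: act_act[OF X(1) G F wX])
  also have "act X (n + k - 1) (n + k) ?f w = const_cube X x (n + k - 1)"
    using w i by (simp add: loop_cells_def)
  finally show ?thesis by (simp only: act_const_cube[OF X G])
qed

text \<open>
  For a \<open>(n + k)\<close>-cube \<open>w\<close> this is the map \<open>\<square>^n/\<partial>\<square>^n \<otimes> \<square>^k \<rightarrow> X\<close> that \<open>w : \<square>^n \<otimes> \<square>^k \<rightarrow> X\<close> induces,
  evaluated at \<open>S \<otimes> t\<close>.
\<close>

definition sphere_fill ::
  "'a cset \<Rightarrow> 'a \<Rightarrow> nat \<Rightarrow> nat \<Rightarrow> 'a \<Rightarrow> nat \<Rightarrow> nat \<Rightarrow> sphere_cell \<Rightarrow> (bool list \<Rightarrow> bool list) \<Rightarrow> 'a" where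
  "sphere_fill X x n k w p q S t =
    sphere_lift (\<lambda>h. act X (p + q) (n + k) (tens p q h t) w) (const_cube X x (p + q)) S"

context
  fixes X :: "'a cset" and x :: 'a and n :: nat
  assumes X: "cubical_set X" "x \<in> cells X 0"
begin

abbreviation fill where "fill \<equiv> sphere_fill X x n"

lemma fill_proj:
  "w \<in> loop_cells X x n k \<Longrightarrow> h \<in> Hom p n \<Longrightarrow> t \<in> Hom q k \<Longrightarrow>
    fill k w p q (sphere_proj n p h) t = act X (p + q) (n + k) (tens p q h t) w"
  unfolding sphere_fill_def by (intro sphere_lift_proj loop_cells_boundary[OF X])

lemma fill_base:
  "w \<in> loop_cells X x n k \<Longrightarrow> t \<in> Hom q k \<Longrightarrow>
    fill k w p q (sphere_base n p) t = const_cube X x (p + q)"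
  unfolding sphere_fill_def by (intro sphere_lift_base loop_cells_boundary[OF X])

lemma fill_cells:
  assumes w: "w \<in> loop_cells X x n k" and S: "S \<in> cells (sphere n) p" and t: "t \<in> Hom q k"
  shows "fill k w p q S t \<in> cells X (p + q)"
  using S
proof (cases rule: sphere_cases)
  case base
  then show ?thesis using fill_base[OF w t] const_cube_cells[OF X] by simp
next
  case (proj h)
  have "w \<in> cells X (n + k)" using w by (simp add: loop_cells_def)
  then show ?thesis using fill_proj[OF w proj(1) t] proj act_cells[OF X(1) tens_Hom[OF proj(1) t]]
    by simp
qed

text \<open>On projected cells this is interchange, on base cells the stability of constant cubes.
  It supplies the naturality hypothesis of \<open>gprod_map_exists\<close>.\<close>

lemma fill_natural:
  assumes w: "w \<in> loop_cells X x n k" and S: "S \<in> cells (sphere n) p" and t: "t \<in> Hom q k"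
    and a: "a \<in> Hom p' p" and b: "b \<in> Hom q' q"
  shows "fill k w p' q' (act (sphere n) p' p a S) (compose (cube q') t b) =
    act X (p' + q') (p + q) (tens p' q' a b) (fill k w p q S t)"
  using S
proof (cases rule: sphere_cases)
  case base
  then show ?thesis
    using act_const_cube[OF X tens_Hom[OF a b]]
    by (simp add: fill_base[OF w] t compose_Hom[OF b t] sphere_act_base[OF a])
next
  case (proj h)
  have "w \<in> cells X (n + k)" using w by (simp add: loop_cells_def)
  then show ?thesis
    using act_act[OF X(1) tens_Hom[OF a b] tens_Hom[OF proj(1) t]]
    by (simp add: proj fill_proj[OF w] t compose_Hom[OF b t] compose_Hom[OF a proj(1)]
        sphere_act_proj[OF a] tens_compose[OF a b])
qed

text \<open>Yoneda: every projected cell is the restriction along \<open>h\<close> of the cell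
  \<open>sphere_proj n n (ident n)\<close>.\<close>

lemma sphere_map_proj:
  assumes F: "F \<in> pointed_maps (sphere n, sphere_pt n) (X, x)" and h: "h \<in> Hom m n"
  shows "F m (sphere_proj n m h) = act X m n h (sphere_cube n F)"
proof -
  have "F m (act (sphere n) m n h (sphere_proj n n (ident n))) = act X m n h (sphere_cube n F)"
    using F h sphere_proj_cells[OF ident_Hom] by (simp add: pointed_maps_def maps_def sphere_cube_def)
  then show ?thesis using h by (simp add: sphere_act_proj)
qed

lemma sphere_map_base:
  assumes F: "F \<in> pointed_maps (sphere n, sphere_pt n) (X, x)"
  shows "F m (sphere_base n m) = const_cube X x m"
proof -
  have "sphere_pt n \<in> cells (sphere n) 0"
    using sphere_base_cells[of n 0] by (simp only: sphere_base_0)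
  then show ?thesis
    using F terminal_Hom[of m] by (simp add: pointed_maps_def maps_def const_cube_def)
qed

lemma sphere_cube_loop_cells:
  assumes F: "F \<in> pointed_maps (sphere n, sphere_pt n) (X, x)"
  shows "sphere_cube n F \<in> loop_cells X x n 0"
proof -
  have "act X (n - 1) n (face (n - 1) i e) (sphere_cube n F) = const_cube X x (n - 1)"
    if i: "1 \<le> i" "i \<le> n" for i e
  proof -
    have f: "face (n - 1) i e \<in> Hom (n - 1) n" using face_Hom[of i "n - 1" e] i by simp
    show ?thesis
      using face_boundary[OF i] sphere_map_proj[OF F f] sphere_map_base[OF F] sphere_proj_boundary by metis
  qed
  moreover have "sphere_cube n F \<in> cells X n"
    using F sphere_proj_cells[OF ident_Hom] by (auto simp: pointed_maps_def maps_def sphere_cube_def)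
  ultimately show ?thesis by (simp add: loop_cells_def)
qed

lemma tens_ident_0: "f \<in> Hom m k \<Longrightarrow> tens m 0 f (ident 0) = f"
  by (rule tens_eqI) (auto simp: Hom_extensional)

text \<open>A pointed map is forced by its cube on projected cells and by the base point on the
  others; this gives injectivity.\<close>

lemma bij_sphere_cube:
  "bij_betw (sphere_cube n) (pointed_maps (sphere n, sphere_pt n) (X, x)) (loop_cells X x n 0)"
  unfolding bij_betw_def
proof
  show "inj_on (sphere_cube n) (pointed_maps (sphere n, sphere_pt n) (X, x))"
  proof (rule inj_onI, rule ext)
    fix F G m assume F: "F \<in> pointed_maps (sphere n, sphere_pt n) (X, x)"
      and G: "G \<in> pointed_maps (sphere n, sphere_pt n) (X, x)"
      and eq: "sphere_cube n F = sphere_cube n G"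
    show "F m = G m"
    proof (rule extensionalityI)
      show "F m \<in> extensional (cells (sphere n) m)" "G m \<in> extensional (cells (sphere n) m)"
        using F G by (auto simp: pointed_maps_def maps_def PiE_def)
      fix S assume "S \<in> cells (sphere n) m"
      then show "F m S = G m S"
        by (cases rule: sphere_cases)
          (simp_all add: sphere_map_proj[OF F] sphere_map_proj[OF G] sphere_map_base[OF F]
            sphere_map_base[OF G] eq)
    qed
  qed
  show "sphere_cube n ` pointed_maps (sphere n, sphere_pt n) (X, x) = loop_cells X x n 0"
  proof
    show "sphere_cube n ` pointed_maps (sphere n, sphere_pt n) (X, x) \<subseteq> loop_cells X x n 0"
      using sphere_cube_loop_cells by blast
    show "loop_cells X x n 0 \<subseteq> sphere_cube n ` pointed_maps (sphere n, sphere_pt n) (X, x)"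
    proof
      fix w assume w: "w \<in> loop_cells X x n 0"
      then have wX: "w \<in> cells X n" by (simp add: loop_cells_def)
      \<comment> \<open>With \<open>k = q = 0\<close> and \<open>t = ident 0\<close> the second
        tensor factor is trivial, and \<open>fill\<close> becomes a map out of the sphere
        itself.\<close>
      define F where "F m = (\<lambda>S\<in>cells (sphere n) m. fill 0 w m 0 S (ident 0))" for m
      have "F m (act (sphere n) m k f S) = act X m k f (F k S)"
        if f: "f \<in> Hom m k" and S: "S \<in> cells (sphere n) k" for m k f S
        using fill_natural[OF w S ident_Hom f ident_Hom] act_cells[OF cubical_set_sphere f S] S
        by (simp add: F_def tens_ident_0[OF f])
      moreover have "F m S \<in> cells X m" if "S \<in> cells (sphere n) m" for m S
        using fill_cells[OF w that ident_Hom] that by (simp add: F_def)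
      moreover have "F 0 (sphere_pt n) = x"
        using fill_base[OF w ident_Hom, of 0] sphere_base_cells[of n 0] const_cube_0[OF X]
        by (simp add: F_def sphere_base_0)
      ultimately have "F \<in> pointed_maps (sphere n, sphere_pt n) (X, x)"
        by (auto simp: pointed_maps_def maps_def F_def)
      moreover have "sphere_cube n F = w"
        using fill_proj[OF w ident_Hom ident_Hom] sphere_proj_cells[OF ident_Hom[of n]] act_ident[OF X(1) wX]
        by (simp add: sphere_cube_def F_def tens_ident)
      ultimately show "w \<in> sphere_cube n ` pointed_maps (sphere n, sphere_pt n) (X, x)" by blast
    qed
  qed
qed


section \<open>Pointed homotopies of maps out of the sphere\<close>

interpretation SI: geometric_product "sphere n" "representable 1"
  by unfold_locales (rule cubical_set_sphere cubical_set_representable)+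

abbreviation cyl_class where "cyl_class \<equiv> gprod_class (sphere n) (representable 1)"

lemma edges_loops:
  "edges (loops n (X, x)) =
    (\<lambda>w. (act X n (n + 1) (tens n 0 (ident n) (face 0 1 False)) w,
      act X n (n + 1) (tens n 0 (ident n) (face 0 1 True)) w)) ` loop_cells X x n 1"
  unfolding edges_def cells_loops[OF X] by (simp only: act_loops[OF X face_0_Hom] add_0_right)

text \<open>The edge is the value of \<open>H\<close> on the image of the top cell of
  \<open>\<square>^n \<otimes> \<square>^1\<close>, viewed as an
  \<open>(n + 1)\<close>-cube.\<close>

lemma homotopy_edge:
  assumes F: "F \<in> pointed_maps (sphere n, sphere_pt n) (X, x)"
    and G: "G \<in> pointed_maps (sphere n, sphere_pt n) (X, x)"
    and H: "pointed_homotopy (sphere n, sphere_pt n) (X, x) F G H"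
  shows "(sphere_cube n F, sphere_cube n G) \<in> edges (loops n (X, x))"
proof -
  let ?\<iota> = "sphere_proj n n (ident n)"
  let ?u = "cyl_class (n + 1) (n, 1, ?\<iota>, ident 1, ident (n + 1))"
  define w where "w = H (n + 1) ?u"
  have H_maps: "H \<in> maps (gprod (sphere n) (representable 1)) X"
    and H_False: "\<And>k c. c \<in> cells (sphere n) k \<Longrightarrow> H k (end_incl (sphere n) False k c) = F k c"
    and H_True: "\<And>k c. c \<in> cells (sphere n) k \<Longrightarrow> H k (end_incl (sphere n) True k c) = G k c"
    and H_base: "\<And>k p q t f. t \<in> Hom q 1 \<Longrightarrow> f \<in> Hom k (p + q) \<Longrightarrow>
      H k (cyl_class k (p, q, sphere_base n p, t, f)) = const_cube X x k"
    using H by (auto simp: pointed_homotopy_def)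
  have \<iota>: "?\<iota> \<in> cells (sphere n) n" by (rule sphere_proj_cells[OF ident_Hom])
  have id1: "ident 1 \<in> cells (representable 1) 1" by (simp add: representable_def)
  have u: "?u \<in> cells (gprod (sphere n) (representable 1)) (n + 1)"
    by (rule SI.gprod_class_cells[OF \<iota> id1 ident_Hom])
  \<comment> \<open>The product of \<open>a\<close> and \<open>b\<close> first enters the operator
    slot of the top class. The coend relation then moves \<open>a\<close> and \<open>b\<close> into
    the two cell slots.\<close>
  have act_w: "act X (p + q) (n + 1) (tens p q a b) w =
      H (p + q) (cyl_class (p + q) (p, q, sphere_proj n p a, b, ident (p + q)))"
    if a: "a \<in> Hom p n" and b: "b \<in> Hom q 1" for p q a b
  proof -
    have ab: "tens p q a b \<in> Hom (p + q) (n + 1)" by (rule tens_Hom[OF a b])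
    have "act X (p + q) (n + 1) (tens p q a b) w =
        H (p + q) (act (gprod (sphere n) (representable 1)) (p + q) (n + 1) (tens p q a b) ?u)"
      using H_maps ab u unfolding w_def maps_def by auto
    also have "act (gprod (sphere n) (representable 1)) (p + q) (n + 1) (tens p q a b) ?u =
        cyl_class (p + q) (n, 1, ?\<iota>, ident 1, tens p q a b)"
      using SI.act_gprod[OF \<iota> id1 ident_Hom ab] ident_compose[OF ab] by simp
    also have "\<dots> = cyl_class (p + q)
        (p, q, act (sphere n) p n a ?\<iota>, act (representable 1) q 1 b (ident 1), ident (p + q))"
      using SI.gprod_class_eq[OF a b \<iota> id1 ident_Hom] compose_ident[OF ab] by simp
    also have "act (representable 1) q 1 b (ident 1) = b"
      using ident_compose[OF b] by (simp add: representable_def)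
    also have "act (sphere n) p n a ?\<iota> = sphere_proj n p a"
      using sphere_act_proj[OF a ident_Hom] ident_compose[OF a] by simp
    finally show ?thesis .
  qed
  \<comment> \<open>For \<open>p = n\<close>, \<open>q = 0\<close>, \<open>a = ident n\<close> and
    \<open>b = face 0 1 e\<close> the class in \<open>act_w\<close> is literally the one in
    \<open>end_incl\<close>.\<close>
  have end_w: "act X n (n + 1) (tens n 0 (ident n) (face 0 1 e)) w =
      H n (end_incl (sphere n) e n ?\<iota>)" for e
    using act_w[OF ident_Hom face_0_Hom, of e] \<iota> by (simp add: end_incl_def)
  have "w \<in> loop_cells X x n 1"
  proof -
    have "act X n (n + 1) (face n i e) w = const_cube X x n" if i: "1 \<le> i" "i \<le> n" for i e
    proof -
      have f: "face (n - 1) i e \<in> Hom (n - 1) n" using face_Hom[of i "n - 1" e] i by simp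
      have "n - 1 + 1 = n" using i by simp
      \<comment> \<open>Take \<open>p = n - 1\<close> and \<open>q = 1\<close> in
        \<open>act_w\<close>: the face projects to the base cell, where \<open>H\<close> is
        constant.\<close>
      then show ?thesis
        using face_boundary[OF i, of e] act_w[OF f ident_Hom] H_base[OF ident_Hom ident_Hom, of "n - 1"]
          face_tens_ident[OF i, of 1 e] sphere_proj_boundary by simp
    qed
    moreover have "w \<in> cells X (n + 1)"
      using H_maps u unfolding w_def maps_def by auto
    ultimately show ?thesis by (simp add: loop_cells_def)
  qed
  moreover have "sphere_cube n F = act X n (n + 1) (tens n 0 (ident n) (face 0 1 False)) w"
    "sphere_cube n G = act X n (n + 1) (tens n 0 (ident n) (face 0 1 True)) w"
    using end_w H_False[OF \<iota>] H_True[OF \<iota>] by (simp_all add: sphere_cube_def)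
  ultimately show ?thesis unfolding edges_loops by blast
qed

text \<open>The homotopy is the map induced by \<open>w\<close> through \<open>fill\<close> with
  \<open>k = 1\<close>, extended over the geometric product by
  \<open>gprod_map_exists\<close>.\<close>

lemma edge_homotopy:
  assumes F: "F \<in> pointed_maps (sphere n, sphere_pt n) (X, x)"
    and G: "G \<in> pointed_maps (sphere n, sphere_pt n) (X, x)"
    and "(sphere_cube n F, sphere_cube n G) \<in> edges (loops n (X, x))"
  shows "\<exists>H. pointed_homotopy (sphere n, sphere_pt n) (X, x) F G H"
proof -
  obtain w where w: "w \<in> loop_cells X x n 1"
    and w_False: "sphere_cube n F = act X n (n + 1) (tens n 0 (ident n) (face 0 1 False)) w"
    and w_True: "sphere_cube n G = act X n (n + 1) (tens n 0 (ident n) (face 0 1 True)) w"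
    using assms(3) unfolding edges_loops by blast
  have wX: "w \<in> cells X (n + 1)" using w by (simp add: loop_cells_def)
  have Hom1: "cells (representable 1) q = Hom q 1"
    "act (representable 1) q' q b t = compose (cube q') t b" for q q' b t
    by (simp_all add: representable_def)
  have "\<exists>H\<in>maps (gprod (sphere n) (representable 1)) X.
      \<forall>k p q. \<forall>S\<in>cells (sphere n) p. \<forall>t\<in>cells (representable 1) q. \<forall>f\<in>Hom k (p + q).
        H k (cyl_class k (p, q, S, t, f)) = act X k (p + q) f (fill 1 w p q S t)"
    by (rule SI.gprod_map_exists[OF X(1)])
      (simp_all only: Hom1 fill_cells[OF w] fill_natural[OF w])
  then obtain H where H_maps: "H \<in> maps (gprod (sphere n) (representable 1)) X"
    and H: "\<And>k p q S t f. S \<in> cells (sphere n) p \<Longrightarrow> t \<in> Hom q 1 \<Longrightarrow> f \<in> Hom k (p + q) \<Longrightarrow>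
        H k (cyl_class k (p, q, S, t, f)) = act X k (p + q) f (fill 1 w p q S t)"
    unfolding Hom1 by blast
  \<comment> \<open>Stated for an arbitrary pointed map \<open>E\<close> so that it covers both
    ends, \<open>F\<close> at \<open>False\<close> and \<open>G\<close> at
    \<open>True\<close>.\<close>
  have H_end: "H k (end_incl (sphere n) e k S) = E k S"
    if E: "E \<in> pointed_maps (sphere n, sphere_pt n) (X, x)"
      and w_e: "sphere_cube n E = act X n (n + 1) (tens n 0 (ident n) (face 0 1 e)) w"
      and S: "S \<in> cells (sphere n) k" for E e k S
  proof -
    have "H k (end_incl (sphere n) e k S) = fill 1 w k 0 S (face 0 1 e)"
      using H[OF S face_0_Hom, of "ident k" k] act_ident[OF X(1) fill_cells[OF w S face_0_Hom]] S
      by (simp add: end_incl_def)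
    also have "\<dots> = E k S"
      using S
    proof (cases rule: sphere_cases)
      case base
      then show ?thesis using fill_base[OF w face_0_Hom] sphere_map_base[OF E] by simp
    next
      case (proj h)
      have T: "tens n 0 (ident n) (face 0 1 e) \<in> Hom n (n + 1)"
        using tens_Hom[OF ident_Hom face_0_Hom, of n e] by simp
      \<comment> \<open>Interchange with trivial second coordinate block: restricting the end face
        of \<open>w\<close> along \<open>h\<close> agrees with evaluating \<open>w\<close> on
        \<open>h\<close> \<otimes> \<open>face 0 1 e\<close>.\<close>
      have "compose (cube k) (tens n 0 (ident n) (face 0 1 e)) h = tens k 0 h (face 0 1 e)"
        using tens_compose[OF proj(1) ident_Hom[of 0], of "ident n" "face 0 1 e"]
          tens_ident_0[OF proj(1)] ident_compose[OF proj(1)] compose_ident[OF face_0_Hom]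
        by simp
      then show ?thesis
        using proj fill_proj[OF w proj(1) face_0_Hom] sphere_map_proj[OF E proj(1)]
          act_act[OF X(1) proj(1) T wX] w_e by simp
    qed
    finally show ?thesis .
  qed
  have "H k (cyl_class k (p, q, sphere_base n p, t, f)) = const_cube X x k"
    if "t \<in> Hom q 1" "f \<in> Hom k (p + q)" for k p q t f
    using H[OF sphere_base_cells that] fill_base[OF w that(1)] act_const_cube[OF X that(2)] by simp
  then have "pointed_homotopy (sphere n, sphere_pt n) (X, x) F G H"
    using H_maps H_end[OF F w_False] H_end[OF G w_True] by (simp add: pointed_homotopy_def)
  then show ?thesis by blast
qed

end

section \<open>Comparison of homotopy classes with path components\<close>

theorem theorem3p20:
  fixes X :: "'a cset" and x :: 'a and n :: nat
  assumes "kan_complex X" and "x \<in> cells X 0"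
  shows "bij_betw (sphere_cube n)
           (pointed_maps (sphere n, sphere_pt n) (X, x)) (cells (loops n (X, x)) 0) \<and>
         (\<exists>\<Psi>. bij_betw \<Psi> (homotopy_classes (sphere n, sphere_pt n) (X, x)) (pi_n n (X, x)) \<and>
           (\<forall>F\<in>pointed_maps (sphere n, sphere_pt n) (X, x).
              \<Psi> (homotopy_rel (sphere n, sphere_pt n) (X, x) `` {F}) =
              pi0_rel (loops n (X, x)) `` {(0, sphere_cube n F)}))"
proof
  have X: "cubical_set X" "x \<in> cells X 0" using assms by (auto simp: kan_complex_def)
  let ?Y = "loops n (X, x)"
  let ?A = "pointed_maps (sphere n, sphere_pt n) (X, x)"
  let ?r = "{(F, G). F \<in> ?A \<and> G \<in> ?A \<and> (\<exists>H. pointed_homotopy (sphere n, sphere_pt n) (X, x) F G H)}"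
  let ?\<phi> = "sphere_cube n"
  note Y = cubical_set_loops[OF X, of n]
  show bij: "bij_betw ?\<phi> ?A (cells ?Y 0)"
    using bij_sphere_cube[OF X] by (simp add: cells_loops[OF X])
  \<comment> \<open>An edge path between two cubes passes through other 0-cubes of the loop space.
    Each of them is the cube of a pointed map, so \<psi> pulls the whole path back to a chain of
    homotopies.\<close>
  define \<psi> where "\<psi> = inv_into ?A ?\<phi>"
  have \<psi>: "\<psi> (?\<phi> F) = F" if "F \<in> ?A" for F
    using bij_betw_inv_into_left[OF bij that] by (simp add: \<psi>_def)
  have r: "(F, G) \<in> ?r \<longleftrightarrow> (?\<phi> F, ?\<phi> G) \<in> edges ?Y" if "F \<in> ?A" "G \<in> ?A" for F G
    using that homotopy_edge[OF X that] edge_homotopy[OF X that] by blast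
  have iff: "(F, G) \<in> homotopy_rel (sphere n, sphere_pt n) (X, x) \<longleftrightarrow>
      ((0, ?\<phi> F), (0, ?\<phi> G)) \<in> pi0_rel ?Y" if FG: "F \<in> ?A" "G \<in> ?A" for F G
  proof -
    have "(F, G) \<in> eq_closure ?A ?r \<longleftrightarrow> (?\<phi> F, ?\<phi> G) \<in> eq_closure (cells ?Y 0) (edges ?Y)"
    proof
      assume "(F, G) \<in> eq_closure ?A ?r"
      then show "(?\<phi> F, ?\<phi> G) \<in> eq_closure (cells ?Y 0) (edges ?Y)"
      proof (rule eq_closure_map[OF _ _ equiv_eq_closure])
        show "(?\<phi> F, ?\<phi> G) \<in> eq_closure (cells ?Y 0) (edges ?Y)" if "(F, G) \<in> ?r" for F G
          using that r[of F G] edges_subset[OF Y] by (intro eq_closure_gen) blast+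
      qed (use bij_betwE[OF bij] in auto)
    next
      assume "(?\<phi> F, ?\<phi> G) \<in> eq_closure (cells ?Y 0) (edges ?Y)"
      then have "(\<psi> (?\<phi> F), \<psi> (?\<phi> G)) \<in> eq_closure ?A ?r"
      proof (rule eq_closure_map[OF _ edges_subset[OF Y] equiv_eq_closure])
        show "\<psi> \<in> cells ?Y 0 \<rightarrow> ?A"
          using bij_betwE[OF bij_betw_inv_into[OF bij]] by (auto simp: \<psi>_def)
        then show "(\<psi> a, \<psi> b) \<in> eq_closure ?A ?r" if "(a, b) \<in> edges ?Y" for a b
          using that r[of "\<psi> a" "\<psi> b"] edges_subset[OF Y] bij_betw_inv_into_right[OF bij]
          by (intro eq_closure_gen) (auto simp: \<psi>_def Pi_iff)
      qed
      then show "(F, G) \<in> eq_closure ?A ?r" using \<psi> FG by simp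
    qed
    \<comment> \<open>On 0-cubes the edge relation and the colimit relation agree by
      \<open>pi0_rel_vertices\<close>.\<close>
    then show ?thesis
      using pi0_rel_vertices[OF Y] bij_betwE[OF bij] FG by (simp add: homotopy_rel_def)
  qed
  show "\<exists>\<Psi>. bij_betw \<Psi> (homotopy_classes (sphere n, sphere_pt n) (X, x)) (pi_n n (X, x)) \<and>
      (\<forall>F\<in>?A. \<Psi> (homotopy_rel (sphere n, sphere_pt n) (X, x) `` {F}) =
        pi0_rel ?Y `` {(0, sphere_cube n F)})"
    unfolding homotopy_classes_def pi_n_def pi0_def
  proof (rule quotient_bij)
    show "equiv ?A (homotopy_rel (sphere n, sphere_pt n) (X, x))"
      unfolding homotopy_rel_def by (rule equiv_eq_closure)
    show "equiv (pi0_carrier ?Y) (pi0_rel ?Y)"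
      unfolding pi0_rel_def by (rule equiv_eq_closure)
    show "(\<lambda>F. (0, ?\<phi> F)) \<in> ?A \<rightarrow> pi0_carrier ?Y"
      using bij_betwE[OF bij] by (auto simp: pi0_carrier_def)
    \<comment> \<open>Here \<open>p\<close> may have any dimension; it is first replaced by a vertex
      in its class, which is the cube of some pointed map.\<close>
    show "\<exists>F\<in>?A. ((0, ?\<phi> F), p) \<in> pi0_rel ?Y" if p: "p \<in> pi0_carrier ?Y" for p
    proof -
      obtain a where a: "a \<in> cells ?Y 0" "((0, a), p) \<in> pi0_rel ?Y"
        using pi0_rel_vertex_exists[OF Y p] by blast
      then obtain F where "F \<in> ?A" "a = ?\<phi> F"
        using bij_betw_imp_surj_on[OF bij] by blast
      with a(2) show ?thesis by blast
    qed
  qed (rule iff)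
qed

end
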